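(* Let $d \geq 2$ be an integer and let $p$ be an odd prime with $p\equiv \pm1 \pmod d$. Then \[ {}_{2}G\left( \tfrac{1}{d}, 1-\tfrac{1}{d} \right)_p \equiv {}_{2}F_1\left[ \begin{array}{cc} \frac{1}{d}, & 1-\frac{1}{d}\\ & 1 \end{array} \Big| \; 1 \right]_{p-1} \pmod {p^2}. \]
   Context: $\Gamma_p$ is Morita's $p$-adic gamma function. For real $x$, $\lfloor x\rfloor$ is the floor and $\langle x\rangle:=x-\lfloor x\rfloor$. For an odd prime $p$, $n\in\mathbb{Z}^+$ and $\frac{m_i}{d_i}\in\mathbb{Q}\cap\mathbb{Z}_p$ with $0<\frac{m_i}{d_i}<1$, define ${}_{n+1}G\left(\tfrac{m_1}{d_1},\dots,\tfrac{m_{n+1}}{d_{n+1}}\right)_p:=\frac{-1}{p-1}\sum_{j=0}^{p-2}\left((-1)^j\Gamma_p(\tfrac{j}{p-1})\right)^{n+1}\prod_{i=1}^{n+1}\frac{\Gamma_p(\langle \frac{m_i}{d_i}-\frac{j}{p-1}\rangle)}{\Gamma_p(\frac{m_i}{d_i})}(-p)^{-\lfloor \frac{m_i}{d_i}-\frac{j}{p-1}\rfloor}$. Rising factorial: $(a)_0:=1$, $(a)_k:=a(a+1)\cdots(a+k-1)$. Truncated hypergeometric series: ${}_rF_s\left[\begin{array}{ccc}a_1,&\dots,&a_r\\ &b_1,\dots,&b_s\end{array}\Big|\,z\right]_m:=\sum_{k=0}^{m}\frac{(a_1)_k\cdots(a_r)_k}{(b_1)_k\cdots(b_s)_k}\frac{z^k}{k!}$.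 Congruences are in $\mathbb{Z}_p$. *)

theory Defs
  imports
    "HOL-Number_Theory.Number_Theory"
    "HOL-Computational_Algebra.Computational_Algebra"
    "Berlekamp_Zassenhaus.Finite_Field"
begin

section \<open>The ring of \<open>p\<close>-adic integers\<close>

text \<open>
  The prime \<open>p\<close> is carried by a type variable, \<open>p = CARD('p)\<close>. A \<open>p\<close>-adic integer is an element
  of the inverse limit of the rings \<open>\<int>/p\<^sup>n\<int>\<close>, each residue class being represented by its member
  in \<open>{0..<p\<^sup>n}\<close>.
\<close>

typedef (overloaded) 'p :: prime_card padic_int =
  "{x :: nat \<Rightarrow> int. \<forall>n. x n \<in> {0..<int CARD('p) ^ n} \<and> x (Suc n) mod int CARD('p) ^ n = x n}"
  by (rule exI[of _ "\<lambda>_. 0"]) simp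

setup_lifting type_definition_padic_int

lemma padic_mod_mod: "(a :: int) mod P ^ Suc n mod P ^ n = a mod P ^ n"
  by (rule mod_mod_cancel) simp

lemma padic_card_gt_1: "int CARD('p :: prime_card) > 1"
  using prime_gt_1_nat[OF prime_card[where ?'a = 'p]] by simp

lemma padic_card_pos: "int CARD('p :: prime_card) ^ n > 0"
  using padic_card_gt_1[where ?'p = 'p] by simp

instantiation padic_int :: (prime_card) comm_ring_1
begin

lift_definition zero_padic_int :: "'a padic_int" is "\<lambda>_. 0"
  by simp

lift_definition one_padic_int :: "'a padic_int" is "\<lambda>n. 1 mod int CARD('a) ^ n"
  using padic_card_pos[where ?'p = 'a] by (simp add: padic_mod_mod del: power_Suc)

lift_definition plus_padic_int :: "'a padic_int \<Rightarrow> 'a padic_int \<Rightarrow> 'a padic_int"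
  is "\<lambda>x y n. (x n + y n) mod int CARD('a) ^ n"
  using padic_card_pos[where ?'p = 'a]
  by (simp add: padic_mod_mod del: power_Suc) (metis mod_add_eq)

lift_definition minus_padic_int :: "'a padic_int \<Rightarrow> 'a padic_int \<Rightarrow> 'a padic_int"
  is "\<lambda>x y n. (x n - y n) mod int CARD('a) ^ n"
  using padic_card_pos[where ?'p = 'a]
  by (simp add: padic_mod_mod del: power_Suc) (metis mod_diff_eq)

lift_definition uminus_padic_int :: "'a padic_int \<Rightarrow> 'a padic_int"
  is "\<lambda>x n. (- x n) mod int CARD('a) ^ n"
  using padic_card_pos[where ?'p = 'a]
  by (simp add: padic_mod_mod del: power_Suc) (metis mod_minus_eq)

lift_definition times_padic_int :: "'a padic_int \<Rightarrow> 'a padic_int \<Rightarrow> 'a padic_int"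
  is "\<lambda>x y n. (x n * y n) mod int CARD('a) ^ n"
  using padic_card_pos[where ?'p = 'a]
  by (simp add: padic_mod_mod del: power_Suc) (metis mod_mult_eq)

instance
proof
  fix a b c :: "'a padic_int"
  show "a + b + c = a + (b + c)"
    by transfer (simp add: mod_simps algebra_simps)
  show "a + b = b + a"
    by transfer (simp add: add.commute)
  show "0 + a = a"
    by transfer auto
  show "- a + a = 0"
    by transfer (simp add: mod_simps)
  show "a - b = a + - b"
    by transfer (simp add: mod_simps)
  show "a * b * c = a * (b * c)"
    by transfer (simp add: mod_simps algebra_simps)
  show "a * b = b * a"
    by transfer (simp add: mult.commute)
  show "1 * a = a"
    by transfer (auto simp: mod_simps)
  show "(a + b) * c = a * c + b * c"
    by transfer (simp add: mod_simps algebra_simps)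
  show "(0 :: 'a padic_int) \<noteq> 1"
  proof transfer
    show "(\<lambda>_. 0) \<noteq> (\<lambda>n. 1 mod int CARD('a) ^ n)"
      using padic_card_gt_1[where ?'p = 'a] by (auto simp: fun_eq_iff intro!: exI[of _ 1])
  qed
qed

end

lemma Rep_padic_int_bounds:
  fixes x :: "'p :: prime_card padic_int"
  shows "Rep_padic_int x n \<ge> 0" "Rep_padic_int x n < int CARD('p) ^ n"
  using Rep_padic_int[of x] by auto

lemma Rep_padic_int_mod:
  fixes x :: "'p :: prime_card padic_int"
  assumes "m \<le> n"
  shows "Rep_padic_int x n mod int CARD('p) ^ m = Rep_padic_int x m"
  using assms
proof (induction n rule: dec_induct)
  case base
  show ?case using Rep_padic_int_bounds[of x m] by simp
next
  case (step n)
  have "int CARD('p) ^ m dvd int CARD('p) ^ n"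
    using step.hyps by (simp add: le_imp_power_dvd)
  then have "Rep_padic_int x (Suc n) mod int CARD('p) ^ m =
      Rep_padic_int x (Suc n) mod int CARD('p) ^ n mod int CARD('p) ^ m"
    by (simp add: mod_mod_cancel)
  also have "Rep_padic_int x (Suc n) mod int CARD('p) ^ n = Rep_padic_int x n"
    using Rep_padic_int[of x] by auto
  finally show ?case using step.IH by simp
qed

lemma Rep_padic_int_of_nat:
  "Rep_padic_int (of_nat k :: 'p :: prime_card padic_int) n = int k mod int CARD('p) ^ n"
  by (induction k)
    (simp_all add: zero_padic_int.rep_eq plus_padic_int.rep_eq one_padic_int.rep_eq mod_simps)

instance padic_int :: (prime_card) idom
proof
  fix a b :: "'a padic_int"
  let ?p = "int CARD('a)"
  assume "a \<noteq> 0" "b \<noteq> 0"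
  then obtain m n where m: "Rep_padic_int a m \<noteq> 0" and n: "Rep_padic_int b n \<noteq> 0"
    by (auto simp: Rep_padic_int_inject[symmetric] zero_padic_int.rep_eq fun_eq_iff)
  define A B where "A = Rep_padic_int a (m + n)" and "B = Rep_padic_int b (m + n)"
  have A: "\<not> ?p ^ m dvd A"
    using m Rep_padic_int_mod[of m "m + n" a] by (simp add: A_def dvd_eq_mod_eq_0)
  have B: "\<not> ?p ^ n dvd B"
    using n Rep_padic_int_mod[of n "m + n" b] by (simp add: B_def dvd_eq_mod_eq_0)
  have p: "prime ?p"
    by (rule prime_card_int)
  have AB0: "A \<noteq> 0" "B \<noteq> 0"
    using A B by auto
  have "multiplicity ?p A < m" "multiplicity ?p B < n"
    using A B by (meson multiplicity_dvd' not_le_imp_less)+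
  moreover have "multiplicity ?p (A * B) = multiplicity ?p A + multiplicity ?p B"
    using p AB0 by (intro prime_elem_multiplicity_mult_distrib) auto
  ultimately have "multiplicity ?p (A * B) < m + n"
    by simp
  moreover have "\<not> is_unit ?p"
    using p not_prime_unit by blast
  ultimately have "\<not> ?p ^ (m + n) dvd A * B"
    using AB0 by (simp add: power_dvd_iff_le_multiplicity)
  then have "Rep_padic_int (a * b) (m + n) \<noteq> 0"
    by (simp add: times_padic_int.rep_eq A_def B_def dvd_eq_mod_eq_0)
  then show "a * b \<noteq> 0"
    by (auto simp: zero_padic_int.rep_eq)
qed

instance padic_int :: (prime_card) ring_char_0
proof
  show "inj (of_nat :: nat \<Rightarrow> 'a padic_int)"
  proof (rule injI)
    fix k l :: nat
    assume eq: "(of_nat k :: 'a padic_int) = of_nat l"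
    have "int (k + l) < int CARD('a) ^ (k + l)"
    proof -
      have "CARD('a) > 1"
        by (rule prime_gt_1_nat[OF prime_card])
      then have "k + l < CARD('a) ^ (k + l)"
        by (simp add: power_gt_expt)
      then show ?thesis
        by (simp only: of_nat_power[symmetric] of_nat_less_iff)
    qed
    then have "int k < int CARD('a) ^ (k + l)" "int l < int CARD('a) ^ (k + l)"
      by linarith+
    with eq show "k = l"
      by (metis Rep_padic_int_of_nat mod_pos_pos_trivial of_nat_0_le_iff of_nat_eq_iff)
  qed
qed

text \<open>The \<open>p\<close>-adic topology: the cosets \<open>x + p\<^sup>n\<int>\<^sub>p\<close> form a neighbourhood basis at \<open>x\<close>.\<close>

instantiation padic_int :: (prime_card) t2_space
begin

definition open_padic_int :: "'a padic_int set \<Rightarrow> bool" where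
  "open_padic_int U \<longleftrightarrow> (\<forall>x\<in>U. \<exists>n. \<forall>y. of_nat CARD('a) ^ n dvd y - x \<longrightarrow> y \<in> U)"

instance
proof
  show "open (UNIV :: 'a padic_int set)"
    by (simp add: open_padic_int_def)
next
  fix S T :: "'a padic_int set"
  assume S: "open S" and T: "open T"
  show "open (S \<inter> T)"
    unfolding open_padic_int_def
  proof
    fix x assume "x \<in> S \<inter> T"
    then obtain m n where
      "\<And>y. of_nat CARD('a) ^ m dvd y - x \<Longrightarrow> y \<in> S"
      "\<And>y. of_nat CARD('a) ^ n dvd y - x \<Longrightarrow> y \<in> T"
      using S T unfolding open_padic_int_def by (metis IntE)
    then show "\<exists>n. \<forall>y. of_nat CARD('a) ^ n dvd y - x \<longrightarrow> y \<in> S \<inter> T"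
      by (intro exI[of _ "m + n"]) (auto simp: power_add dest: dvd_mult_left dvd_mult_right)
  qed
next
  fix K :: "'a padic_int set set"
  assume "\<forall>S\<in>K. open S"
  then show "open (\<Union> K)"
    unfolding open_padic_int_def by (meson UnionE UnionI)
next
  fix x y :: "'a padic_int"
  assume "x \<noteq> y"
  then obtain n where "Rep_padic_int (x - y) n \<noteq> 0"
    by (metis Rep_padic_int_inject eq_iff_diff_eq_0 ext zero_padic_int.rep_eq)
  moreover have "Rep_padic_int z n = 0" if dvd: "of_nat CARD('a) ^ n dvd z" for z :: "'a padic_int"
  proof -
    obtain w where "z = of_nat (CARD('a) ^ n) * w"
      using dvd by auto
    then show ?thesis
      by (simp add: times_padic_int.rep_eq Rep_padic_int_of_nat del: of_nat_power)
        (simp add: mod_simps)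
  qed
  ultimately have n: "\<not> of_nat CARD('a) ^ n dvd x - y"
    by blast
  define B where "B = (\<lambda>u :: 'a padic_int. {z. of_nat CARD('a) ^ n dvd z - u})"
  have "open (B u)" for u
    unfolding open_padic_int_def B_def
  proof (intro ballI exI[of _ n] allI impI)
    fix v w :: "'a padic_int"
    assume "v \<in> {z. of_nat CARD('a) ^ n dvd z - u}" "of_nat CARD('a) ^ n dvd w - v"
    then have "of_nat CARD('a) ^ n dvd (w - v) + (v - u)"
      by (intro dvd_add) auto
    then show "w \<in> {z. of_nat CARD('a) ^ n dvd z - u}"
      by simp
  qed
  moreover have "x \<in> B x" "y \<in> B y"
    by (simp_all add: B_def)
  moreover have "B x \<inter> B y = {}"
  proof (rule ccontr)
    assume "B x \<inter> B y \<noteq> {}"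
    then obtain z where "of_nat CARD('a) ^ n dvd z - x" "of_nat CARD('a) ^ n dvd z - y"
      by (auto simp: B_def)
    then have "of_nat CARD('a) ^ n dvd (z - y) - (z - x)"
      by (rule dvd_diff[rotated])
    with n show False
      by simp
  qed
  ultimately show "\<exists>U V. open U \<and> open V \<and> x \<in> U \<and> y \<in> V \<and> U \<inter> V = {}"
    by blast
qed

end


section \<open>The field of \<open>p\<close>-adic numbers\<close>

type_synonym 'p padic = "'p padic_int fract"

instance fract :: ("{idom, ring_char_0}") field_char_0
proof
  show "inj (of_nat :: nat \<Rightarrow> 'a fract)"
    by (rule injI) (simp add: of_nat_fract eq_fract)
qed

definition padic_integers :: "'p :: prime_card padic set" (\<open>\<int>\<^sub>p\<close>) where
  "\<int>\<^sub>p = range to_fract"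

text \<open>\<open>x \<equiv> y (mod m)\<close> in \<open>\<int>\<^sub>p\<close>; in particular both sides are \<open>p\<close>-adic integers.\<close>

definition padic_cong :: "'p :: prime_card padic \<Rightarrow> 'p padic \<Rightarrow> nat \<Rightarrow> bool" where
  "padic_cong x y m \<longleftrightarrow> x \<in> \<int>\<^sub>p \<and> y \<in> \<int>\<^sub>p \<and> (\<exists>z\<in>\<int>\<^sub>p. x - y = of_nat m * z)"

text \<open>The inclusion of \<open>\<rat> \<inter> \<int>\<^sub>p\<close> in \<open>\<int>\<^sub>p\<close>; the value is unspecified if \<open>p\<close> divides the denominator.\<close>

definition padic_int_of_rat :: "rat \<Rightarrow> 'p :: prime_card padic_int" where
  "padic_int_of_rat q = (THE z. to_fract z = of_rat q)"


section \<open>Morita's \<open>p\<close>-adic gamma function\<close>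

definition padic_gamma_nat :: "nat \<Rightarrow> 'p :: prime_card padic_int" where
  "padic_gamma_nat n = (- 1) ^ n * (\<Prod>j | 0 < j \<and> j < n \<and> \<not> CARD('p) dvd j. of_nat j)"

text \<open>\<open>\<Gamma>\<^sub>p(x)\<close> is the limit of \<open>\<Gamma>\<^sub>p(n)\<close> as the positive integer \<open>n\<close> tends \<open>p\<close>-adically to \<open>x\<close>.\<close>

definition padic_gamma :: "'p :: prime_card padic_int \<Rightarrow> 'p padic_int" where
  "padic_gamma x = Lim (inf (filtercomap of_nat (nhds x)) (principal {0<..})) padic_gamma_nat"

definition padic_gamma_rat :: "rat \<Rightarrow> 'p :: prime_card padic" where
  "padic_gamma_rat q = to_fract (padic_gamma (padic_int_of_rat q))"


section \<open>Hypergeometric functions\<close>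

text \<open>
  The function \<open>\<^sub>n\<^sub>+\<^sub>1G\<close>, the list \<open>as\<close> consisting of the \<open>n + 1\<close> arguments \<open>m\<^sub>i/d\<^sub>i\<close>.
\<close>

definition padic_G :: "rat list \<Rightarrow> 'p :: prime_card padic" where
  "padic_G as =
    (let p = CARD('p) in
      (- 1) / (of_nat p - 1) *
      (\<Sum>j = 0..p - 2.
        ((- 1) ^ j * padic_gamma_rat (of_nat j / (of_nat p - 1))) ^ length as *
        (\<Prod>a\<leftarrow>as.
          padic_gamma_rat (frac (a - of_nat j / (of_nat p - 1))) / padic_gamma_rat a *
          (- of_nat p) powi (- \<lfloor>a - of_nat j / (of_nat p - 1)\<rfloor>))))"

definition truncated_hypergeometric ::
    "'a :: field_char_0 list \<Rightarrow> 'a list \<Rightarrow> 'a \<Rightarrow> nat \<Rightarrow> 'a" where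
  "truncated_hypergeometric as bs z m =
    (\<Sum>k = 0..m. (\<Prod>a\<leftarrow>as. pochhammer a k) / (\<Prod>b\<leftarrow>bs. pochhammer b k) * (z ^ k / fact k))"

end

theory Submission
  imports Defs
begin

text \<open>
  Let \<open>a = 1/d\<close>, let \<open>r = \<lfloor>(p - 1)/d\<rfloor>\<close>, and let \<open>b\<close> be the one of \<open>a\<close>, \<open>1 - a\<close> that is congruent to \<open>-r\<close>
  modulo \<open>p\<close>; then \<open>b = -r + p a\<close> exactly. By the functional equation and the reflection formula of \<open>\<Gamma>\<^sub>p\<close>, the \<open>j\<close>-th
  terms of both sides are values of the same quotient
  \<open>\<Lambda>(y) = \<Gamma>\<^sub>p(b + y) \<Gamma>\<^sub>p(1 - b + y) / (\<Gamma>\<^sub>p(b) \<Gamma>\<^sub>p(1 - b) \<Gamma>\<^sub>p(1 + y)\<^sup>2)\<close>, up to elementary factors: at \<open>y = j\<close> for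
  \<open>\<^sub>2F\<^sub>1\<close> and at \<open>y = -j/(p - 1) = j + p y\<close> for \<open>\<^sub>2G\<close>. Both points are integers modulo \<open>p\<close>, so \<open>\<Lambda>\<close> is known there
  modulo \<open>p\<^sup>2\<close> from factorials and harmonic numbers \<open>H\<^sub>n\<close>. The terms with \<open>j \<ge> p - r\<close> vanish modulo \<open>p\<^sup>2\<close>, those
  with \<open>r < j < p - r\<close> vanish modulo \<open>p\<close>, and the difference of the two sides is \<open>p S\<close> modulo \<open>p\<^sup>2\<close> with
  \<open>S = (\<Sum>j\<le>r. w\<^sub>j (1 + j (H\<^bsub>r-j\<^esub> + H\<^bsub>r+j\<^esub> - 2 H\<^sub>j))) + (-1)\<^sup>r (\<Sum>r<j<p-r. R j)\<close>, where
  \<open>w\<^sub>j = (-1)\<^sup>j (r choose j) ((r + j) choose j)\<close> and \<open>R x = (\<Prod>i=1..r. (x + i)/(x - i))\<close>.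
  The residue of \<open>R\<close> at \<open>i\<close> is \<open>(-1)\<^sup>r i w\<^sub>i\<close>. Its partial fraction expansion, evaluated at \<open>0\<close>, at
  \<open>-1, ..., -r\<close> (the zeros of \<open>R\<close>) and summed over \<open>r < j < p\<close>, gives \<open>S \<equiv> 0\<close> modulo \<open>p\<close>.
\<close>

section \<open>Residues of p-adic integers\<close>

lemma CARD_prime_card_gt_1: "CARD('p :: prime_card) > 1"
  by (rule prime_gt_1_nat[OF prime_card])

abbreviation padic_int_cong :: "'p :: prime_card padic_int \<Rightarrow> nat \<Rightarrow> 'p padic_int \<Rightarrow> bool"
    (\<open>(_ \<equiv>\<^bsub>_\<^esub> _)\<close> [51, 0, 51] 50) where
  "x \<equiv>\<^bsub>k\<^esub> y \<equiv> Rep_padic_int x k = Rep_padic_int y k"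

lemma padic_int_eqI: "(\<And>k. x \<equiv>\<^bsub>k\<^esub> y) \<Longrightarrow> x = y"
  by (simp add: Rep_padic_int_inject[symmetric] ext)

lemma Rep_padic_int_0_right [simp]: "Rep_padic_int x 0 = 0"
  using Rep_padic_int_bounds[of x 0] by simp

lemma padic_int_of_coherent_residues:
  fixes a :: "nat \<Rightarrow> int"
  assumes "\<And>n. [a (Suc n) = a n] (mod int CARD('p :: prime_card) ^ n)"
  obtains x :: "'p :: prime_card padic_int" where "\<And>n. Rep_padic_int x n = a n mod int CARD('p) ^ n"
proof -
  let ?P = "int CARD('p)"
  define f where "f n = a n mod ?P ^ n" for n
  have "f \<in> {x. \<forall>n. x n \<in> {0..<?P ^ n} \<and> x (Suc n) mod ?P ^ n = x n}"
    using padic_card_pos[where ?'p = 'p] assms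
    by (auto simp: f_def cong_def padic_mod_mod simp del: power_Suc)
  then have "Rep_padic_int (Abs_padic_int f :: 'p padic_int) n = a n mod ?P ^ n" for n
    by (simp add: Abs_padic_int_inverse f_def)
  then show ?thesis
    by (rule that)
qed

lemma padic_int_dvd_iff:
  fixes x :: "'p :: prime_card padic_int"
  shows "of_nat CARD('p) ^ n dvd x \<longleftrightarrow> Rep_padic_int x n = 0"
proof
  assume "of_nat CARD('p) ^ n dvd x"
  then obtain w where "x = of_nat (CARD('p) ^ n) * w"
    by auto
  then show "Rep_padic_int x n = 0"
    by (simp add: times_padic_int.rep_eq Rep_padic_int_of_nat flip: of_nat_power)
next
  let ?P = "int CARD('p)"
  assume residue_0: "Rep_padic_int x n = 0"
  define a where "a m = Rep_padic_int x (n + m) div ?P ^ n" for m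
  have a: "?P ^ n * a m = Rep_padic_int x (n + m)" for m
    using Rep_padic_int_mod[of n "n + m" x] residue_0 by (simp add: a_def dvd_eq_mod_eq_0)
  have "[?P ^ n * a (Suc m) = ?P ^ n * a m] (mod ?P ^ n * ?P ^ m)" for m
    using Rep_padic_int_mod[of "n + m" "n + Suc m" x] Rep_padic_int_mod[of "n + m" "n + m" x]
    by (simp only: a cong_def power_add[symmetric])
  then have "[a (Suc m) = a m] (mod ?P ^ m)" for m
    using padic_card_pos[where ?'p = 'p, of n] by (simp add: cong_iff_dvd_diff flip: right_diff_distrib)
  then obtain y :: "'p padic_int" where y: "\<And>m. Rep_padic_int y m = a m mod ?P ^ m"
    using padic_int_of_coherent_residues by metis
  have "x = of_nat (CARD('p) ^ n) * y"
  proof (rule padic_int_eqI)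
    fix m
    have "Rep_padic_int (of_nat (CARD('p) ^ n) * y) m = ?P ^ n * a m mod ?P ^ m"
      by (simp add: times_padic_int.rep_eq Rep_padic_int_of_nat y mod_simps del: of_nat_power)
        (simp add: mod_simps)
    then show "x \<equiv>\<^bsub>m\<^esub> of_nat (CARD('p) ^ n) * y"
      using Rep_padic_int_mod[of m "n + m" x] by (simp add: a)
  qed
  then show "of_nat CARD('p) ^ n dvd x"
    by simp
qed

lemma padic_int_cong_iff_dvd:
  fixes x y :: "'p :: prime_card padic_int"
  shows "x \<equiv>\<^bsub>n\<^esub> y \<longleftrightarrow> of_nat CARD('p) ^ n dvd x - y"
proof -
  have "x \<equiv>\<^bsub>n\<^esub> y \<longleftrightarrow> [Rep_padic_int x n = Rep_padic_int y n] (mod int CARD('p) ^ n)"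
    using Rep_padic_int_bounds[of x n] Rep_padic_int_bounds[of y n] by (simp add: cong_def)
  also have "\<dots> \<longleftrightarrow> Rep_padic_int (x - y) n = 0"
    by (simp add: cong_iff_dvd_diff dvd_eq_mod_eq_0 minus_padic_int.rep_eq)
  finally show ?thesis
    by (simp add: padic_int_dvd_iff)
qed

lemma padic_int_approx_of_nat:
  fixes x :: "'p :: prime_card padic_int"
  obtains m :: nat where "m > 0" "of_nat m \<equiv>\<^bsub>k\<^esub> x"
proof
  let ?m = "nat (Rep_padic_int x k) + CARD('p) ^ k"
  show "?m > 0"
    by simp
  show "of_nat ?m \<equiv>\<^bsub>k\<^esub> x"
    using Rep_padic_int_bounds[of x k] by (simp add: Rep_padic_int_of_nat del: of_nat_add) simp
qed

lemma coprime_Rep_padic_int: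
  fixes x :: "'p :: prime_card padic_int"
  assumes "\<not> of_nat CARD('p) dvd x"
  shows "coprime (Rep_padic_int x n) (int CARD('p) ^ n)"
proof (cases "n = 0")
  case False
  then have "Rep_padic_int x n mod int CARD('p) = Rep_padic_int x 1"
    using Rep_padic_int_mod[of 1 n x] by simp
  moreover have "Rep_padic_int x 1 \<noteq> 0"
    using assms padic_int_dvd_iff[of 1 x] by simp
  ultimately have "\<not> int CARD('p) dvd Rep_padic_int x n"
    by (auto simp: dvd_eq_mod_eq_0)
  then have "coprime (int CARD('p)) (Rep_padic_int x n)"
    using prime_card_int by (rule prime_imp_coprime[rotated])
  then show ?thesis
    by (simp add: coprime_commute)
qed simp

lemma padic_int_unit:
  fixes x :: "'p :: prime_card padic_int"
  assumes "\<not> of_nat CARD('p) dvd x"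
  shows "x dvd 1"
proof -
  let ?P = "int CARD('p)" and ?X = "Rep_padic_int x"
  define a where "a n = modular_inverse (?P ^ n) (?X n)" for n
  have inverse: "[?X n * a n = 1] (mod ?P ^ n)" for n
    unfolding a_def using coprime_Rep_padic_int[OF assms] by (rule cong_modular_inverse1)
  have "[a (Suc n) = a n] (mod ?P ^ n)" for n
  proof -
    have "[?X n = ?X (Suc n)] (mod ?P ^ n)"
      using Rep_padic_int_mod[of n "Suc n" x] Rep_padic_int_mod[of n n x] by (simp add: cong_def)
    then have "[?X n * a (Suc n) = ?X (Suc n) * a (Suc n)] (mod ?P ^ n)"
      by (rule cong_scalar_right)
    also have "[?X (Suc n) * a (Suc n) = 1] (mod ?P ^ n)"
      using inverse[of "Suc n"] by (rule cong_dvd_modulus) simp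
    also have "[1 = ?X n * a n] (mod ?P ^ n)"
      using inverse by (rule cong_sym)
    finally show ?thesis
      using coprime_Rep_padic_int[OF assms] by (simp add: cong_mult_lcancel)
  qed
  then obtain y :: "'p padic_int" where y: "\<And>n. Rep_padic_int y n = a n mod ?P ^ n"
    using padic_int_of_coherent_residues by metis
  have "1 = x * y"
    using inverse by (intro padic_int_eqI)
      (simp add: times_padic_int.rep_eq one_padic_int.rep_eq y cong_def mod_simps)
  then show ?thesis
    by (rule dvdI)
qed

lemma eventually_nhds_padic_int:
  fixes x :: "'p :: prime_card padic_int"
  shows "eventually P (nhds x) \<longleftrightarrow> (\<exists>k. \<forall>y. y \<equiv>\<^bsub>k\<^esub> x \<longrightarrow> P y)"
proof
  assume "eventually P (nhds x)"
  then show "\<exists>k. \<forall>y. y \<equiv>\<^bsub>k\<^esub> x \<longrightarrow> P y"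
    unfolding eventually_nhds open_padic_int_def padic_int_cong_iff_dvd by metis
next
  assume "\<exists>k. \<forall>y. y \<equiv>\<^bsub>k\<^esub> x \<longrightarrow> P y"
  then obtain k where "\<And>y. y \<equiv>\<^bsub>k\<^esub> x \<Longrightarrow> P y"
    by blast
  moreover have "open {y. y \<equiv>\<^bsub>k\<^esub> x}"
    unfolding open_padic_int_def padic_int_cong_iff_dvd[symmetric]
    by (auto intro!: exI[of _ k])
  ultimately show "eventually P (nhds x)"
    unfolding eventually_nhds by (intro exI[of _ "{y. y \<equiv>\<^bsub>k\<^esub> x}"]) auto
qed

lemma positive_nats_near_padic_int_nontrivial:
  fixes x :: "'p :: prime_card padic_int"
  shows "inf (filtercomap of_nat (nhds x)) (principal {0<..}) \<noteq> (bot :: nat filter)"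
proof
  assume "inf (filtercomap of_nat (nhds x)) (principal {0<..}) = (bot :: nat filter)"
  then have "\<forall>\<^sub>F m in filtercomap of_nat (nhds x). \<not> 0 < (m :: nat)"
    by (simp add: trivial_limit_def eventually_inf_principal)
  then obtain k where "\<And>m. of_nat m \<equiv>\<^bsub>k\<^esub> x \<Longrightarrow> \<not> 0 < m"
    unfolding eventually_filtercomap eventually_nhds_padic_int by metis
  then show False
    using padic_int_approx_of_nat[of k x] by blast
qed

lemma padic_int_interpolation_limit:
  fixes f :: "nat \<Rightarrow> 'p :: prime_card padic_int" and x :: "'p padic_int"
  assumes f: "\<And>k m n. [int m = int n] (mod int CARD('p) ^ k) \<Longrightarrow> f m \<equiv>\<^bsub>k\<^esub> f n"
  obtains L :: "'p :: prime_card padic_int" where "\<And>m k. of_nat m \<equiv>\<^bsub>k\<^esub> x \<Longrightarrow> f m \<equiv>\<^bsub>k\<^esub> L"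
proof -
  have f_cong: "f m \<equiv>\<^bsub>k\<^esub> f n"
    if "of_nat m \<equiv>\<^bsub>k\<^esub> x" "of_nat n \<equiv>\<^bsub>k\<^esub> x" for k m n
    using that by (intro f) (simp add: Rep_padic_int_of_nat cong_def)
  have "\<exists>m. of_nat m \<equiv>\<^bsub>k\<^esub> x" for k
    using padic_int_approx_of_nat[of k x] by blast
  then obtain N where N: "\<And>k. of_nat (N k) \<equiv>\<^bsub>k\<^esub> x"
    by metis
  have "[Rep_padic_int (f (N (Suc k))) (Suc k) = Rep_padic_int (f (N k)) k] (mod int CARD('p) ^ k)" for k
  proof -
    have "of_nat (N (Suc k)) \<equiv>\<^bsub>k\<^esub> x"
      using N[of "Suc k"] Rep_padic_int_mod[of k "Suc k" "of_nat (N (Suc k)) :: 'p padic_int"]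
        Rep_padic_int_mod[of k "Suc k" x] by simp
    then have "f (N (Suc k)) \<equiv>\<^bsub>k\<^esub> f (N k)"
      using N by (rule f_cong)
    then show ?thesis
      using Rep_padic_int_mod[of k "Suc k" "f (N (Suc k))"] Rep_padic_int_mod[of k k "f (N k)"]
      by (simp add: cong_def)
  qed
  then obtain L :: "'p padic_int" where L:
      "\<And>k. Rep_padic_int L k = Rep_padic_int (f (N k)) k mod int CARD('p) ^ k"
    by (rule padic_int_of_coherent_residues) blast
  show ?thesis
  proof (rule that)
    fix m k
    assume "of_nat m \<equiv>\<^bsub>k\<^esub> x"
    from f_cong[OF this N] show "f m \<equiv>\<^bsub>k\<^esub> L"
      using Rep_padic_int_bounds[of "f (N k)" k] by (simp add: L)
  qed
qed

lemma Lim_interpolation_padic_int_cong: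
  fixes f :: "nat \<Rightarrow> 'p :: prime_card padic_int" and x :: "'p padic_int"
  assumes f: "\<And>k m n. [int m = int n] (mod int CARD('p) ^ k) \<Longrightarrow> f m \<equiv>\<^bsub>k\<^esub> f n"
    and n: "of_nat n \<equiv>\<^bsub>k\<^esub> x"
  shows "Lim (inf (filtercomap of_nat (nhds x)) (principal {0<..})) f \<equiv>\<^bsub>k\<^esub> f n"
    (is "Lim ?F f \<equiv>\<^bsub>k\<^esub> _")
proof -
  obtain L :: "'p padic_int" where L: "\<And>m k. of_nat m \<equiv>\<^bsub>k\<^esub> x \<Longrightarrow> f m \<equiv>\<^bsub>k\<^esub> L"
    using padic_int_interpolation_limit[where f = f and x = x, OF f] by blast
  have "(f \<longlongrightarrow> L) ?F"
    unfolding filterlim_iff eventually_nhds_padic_int eventually_inf_principal eventually_filtercomap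
  proof (intro allI impI)
    fix P :: "'p padic_int \<Rightarrow> bool"
    assume "\<exists>k. \<forall>y. y \<equiv>\<^bsub>k\<^esub> L \<longrightarrow> P y"
    then obtain k where "\<And>y. y \<equiv>\<^bsub>k\<^esub> L \<Longrightarrow> P y"
      by blast
    then show "\<exists>Q. (\<exists>k. \<forall>y :: 'p padic_int. y \<equiv>\<^bsub>k\<^esub> x \<longrightarrow> Q y) \<and>
        (\<forall>m. Q (of_nat m) \<longrightarrow> m \<in> {0<..} \<longrightarrow> P (f m))"
      using L by (intro exI[of _ "\<lambda>y. y \<equiv>\<^bsub>k\<^esub> x"]) auto
  qed
  then have "Lim ?F f = L"
    by (rule tendsto_Lim[OF positive_nats_near_padic_int_nontrivial])
  then show ?thesis
    using L[OF n] by simp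
qed

section \<open>Morita's gamma function on the p-adic integers\<close>

lemma cong_square_1_odd_prime_power:
  fixes h :: int
  assumes "prime p" "odd p" "[h\<^sup>2 = 1] (mod p ^ k)"
  shows "[h = 1] (mod p ^ k) \<or> [h = - 1] (mod p ^ k)"
proof -
  have dvd: "p ^ k dvd (h - 1) * (h + 1)"
    using assms(3) by (simp add: cong_iff_dvd_diff power2_eq_square algebra_simps)
  have "\<not> (p dvd h - 1 \<and> p dvd h + 1)"
  proof
    assume "p dvd h - 1 \<and> p dvd h + 1"
    then have "p dvd 2"
      using dvd_diff[of p "h + 1" "h - 1"] by simp
    then show False
      using assms primes_dvd_imp_eq[of p 2] by auto
  qed
  then have "coprime (p ^ k) (h - 1) \<or> coprime (p ^ k) (h + 1)"
    using assms(1) by (auto intro: prime_imp_coprime)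
  then show ?thesis
    using dvd by (auto simp: cong_iff_dvd_diff coprime_dvd_mult_right_iff coprime_dvd_mult_left_iff)
qed

lemma prod_totatives_odd_prime_power:
  assumes "prime p" "odd p" "k > 0"
  shows "[(\<Prod>j\<in>totatives (p ^ k). int j) = - 1] (mod int (p ^ k))"
proof -
  let ?q = "p ^ k" and ?\<phi> = "totient (p ^ k)"
  have "p > 2"
    using assms prime_gt_1_nat[of p] by (cases "p = 2") auto
  moreover have "p \<le> ?q"
    using assms \<open>p > 2\<close> by (intro self_le_power) auto
  ultimately have q: "?q > 2"
    by simp
  obtain g where "residue_primroot ?q g"
    using residue_primroot_odd_prime_power_exists[of p] assms by metis
  then have ord_g: "ord ?q g = ?\<phi>" and bij: "bij_betw (\<lambda>i. g ^ i mod ?q) {..<?\<phi>} (totatives ?q)"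
    using q residue_primroot_is_generator[of ?q g] by (auto simp: residue_primroot_def)
  obtain m where m: "?\<phi> = 2 * m"
    using totient_even[OF q] by (elim evenE)
  moreover have "0 < ?\<phi>"
    using q by (intro totient_gt_0_iff[THEN iffD2]) linarith
  ultimately have "m > 0"
    by simp
  have "[(int g ^ m)\<^sup>2 = 1] (mod int ?q)"
    using ord[of g ?q] by (simp add: ord_g m cong_int_iff[symmetric] mult.commute flip: power_mult)
  moreover have "\<not> [int g ^ m = 1] (mod int ?q)"
    using ord_minimal[of m ?q g] \<open>m > 0\<close> by (simp add: ord_g m cong_int_iff[symmetric])
  ultimately have "[int g ^ m = - 1] (mod int ?q)"
    using cong_square_1_odd_prime_power[of "int p" "int g ^ m" k] assms by simp
  then have power_cong: "[(int g ^ m) ^ (2 * m - 1) = (- 1) ^ (2 * m - 1)] (mod int ?q)"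
    by (rule cong_pow)
  have sum_lessThan_double: "(\<Sum>i<2 * n. i) = n * (2 * n - 1)" for n :: nat
    by (induction n) (simp_all add: algebra_simps diff_mult_distrib2)
  have "(\<Prod>j\<in>totatives ?q. int j) = (\<Prod>i<?\<phi>. int (g ^ i mod ?q))"
    using prod.reindex_bij_betw[OF bij, of int] by simp
  also have "[\<dots> = (\<Prod>i<?\<phi>. int g ^ i)] (mod int ?q)"
    by (intro cong_prod) (simp add: cong_def zmod_int)
  also have "(\<Prod>i<?\<phi>. int g ^ i) = (int g ^ m) ^ (2 * m - 1)"
    by (simp add: m sum_lessThan_double power_sum[symmetric] power_mult[symmetric])
  also note power_cong
  also have "(- 1) ^ (2 * m - 1) = (- 1 :: int)"
    using \<open>m > 0\<close> by (simp add: uminus_power_if)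
  finally show ?thesis .
qed

lemma padic_gamma_nat_Suc:
  "(padic_gamma_nat (Suc n) :: 'p :: prime_card padic_int) =
     - (if CARD('p) dvd n then 1 else of_nat n) * padic_gamma_nat n"
proof -
  have "{j. 0 < j \<and> j < Suc n \<and> \<not> CARD('p) dvd j} =
      (if CARD('p) dvd n then {} else {n}) \<union> {j. 0 < j \<and> j < n \<and> \<not> CARD('p) dvd j}"
    by (auto simp: less_Suc_eq intro!: Nat.gr0I)
  then have "(\<Prod>j | 0 < j \<and> j < Suc n \<and> \<not> CARD('p) dvd j. of_nat j :: 'p padic_int) =
      (\<Prod>j \<in> (if CARD('p) dvd n then {} else {n}). of_nat j) *
      (\<Prod>j | 0 < j \<and> j < n \<and> \<not> CARD('p) dvd j. of_nat j)"
    by (simp only:) (subst prod.union_disjoint, auto)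
  then show ?thesis
    by (simp add: padic_gamma_nat_def)
qed

lemma Rep_padic_int_of_int:
  "Rep_padic_int (of_int m :: 'p :: prime_card padic_int) n = m mod int CARD('p) ^ n"
  by (cases m) (simp_all add: Rep_padic_int_of_nat uminus_padic_int.rep_eq mod_simps del: of_nat_Suc)

lemma padic_gamma_nat_prime_power:
  assumes "odd CARD('p :: prime_card)"
  shows "padic_gamma_nat (CARD('p) ^ k) \<equiv>\<^bsub>k\<^esub> (1 :: 'p padic_int)"
proof (cases "k = 0")
  case False
  let ?q = "CARD('p) ^ k"
  have p: "prime CARD('p)"
    by (rule prime_card)
  have coprime_iff: "coprime j ?q \<longleftrightarrow> \<not> CARD('p) dvd j" for j
  proof -
    have "coprime j ?q \<longleftrightarrow> coprime CARD('p) j"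
      using False by (simp add: coprime_commute)
    also have "\<dots> \<longleftrightarrow> \<not> CARD('p) dvd j"
      using p prime_imp_coprime by (metis coprime_common_divisor dvd_refl not_prime_unit)
    finally show ?thesis .
  qed
  have "CARD('p) dvd ?q"
    using False by simp
  then have "{j. 0 < j \<and> j < ?q \<and> \<not> CARD('p) dvd j} = totatives ?q"
    unfolding totatives_def coprime_iff by (auto simp: le_less simp del: dvd_power_iff_le)
  then have "(padic_gamma_nat ?q :: 'p padic_int) = of_int (- (\<Prod>j\<in>totatives ?q. int j))"
    using assms by (simp add: padic_gamma_nat_def)
  moreover have "[- (\<Prod>j\<in>totatives ?q. int j) = 1] (mod int ?q)"
    using cong_minus_minus_iff[THEN iffD2, OF prod_totatives_odd_prime_power[OF p assms, of k]] False
    by simp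
  ultimately show ?thesis
    by (simp add: Rep_padic_int_of_int one_padic_int.rep_eq cong_def del: of_int_minus)
qed simp

lemma padic_gamma_nat_add_prime_power:
  assumes "odd CARD('p :: prime_card)"
  shows "padic_gamma_nat (n + CARD('p) ^ k) \<equiv>\<^bsub>k\<^esub> (padic_gamma_nat n :: 'p padic_int)"
proof (cases "k = 0")
  case False
  show ?thesis
  proof (induction n)
    case 0
    show ?case
      using padic_gamma_nat_prime_power[OF assms] by (simp add: padic_gamma_nat_def)
  next
    case (Suc n)
    let ?m = "n + CARD('p) ^ k"
    have "CARD('p) dvd ?m \<longleftrightarrow> CARD('p) dvd n"
      using False by (simp add: dvd_add_left_iff)
    moreover have "of_nat ?m \<equiv>\<^bsub>k\<^esub> (of_nat n :: 'p padic_int)"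
      by (simp only: Rep_padic_int_of_nat) simp
    ultimately show ?case
      using Suc
      by (simp add: padic_gamma_nat_Suc times_padic_int.rep_eq uminus_padic_int.rep_eq del: of_nat_add)
  qed
qed simp

lemma padic_gamma_nat_cong:
  assumes "odd CARD('p :: prime_card)" "[int m = int n] (mod int CARD('p) ^ k)"
  shows "padic_gamma_nat m \<equiv>\<^bsub>k\<^esub> (padic_gamma_nat n :: 'p padic_int)"
proof -
  have add: "padic_gamma_nat (n + t * CARD('p) ^ k) \<equiv>\<^bsub>k\<^esub> (padic_gamma_nat n :: 'p padic_int)" for n t
    using padic_gamma_nat_add_prime_power[OF assms(1)]
    by (induction t)
      (simp_all add: add.left_commute[of n] add.commute[of "CARD('p) ^ k"] flip: add.assoc)
  have "padic_gamma_nat n \<equiv>\<^bsub>k\<^esub> (padic_gamma_nat (n mod CARD('p) ^ k) :: 'p padic_int)" for n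
    using add[of "n mod CARD('p) ^ k" "n div CARD('p) ^ k"] by (metis mod_div_mult_eq)
  moreover have "m mod CARD('p) ^ k = n mod CARD('p) ^ k"
    using assms(2) by (simp add: cong_int_iff flip: of_nat_power) (simp add: cong_def)
  ultimately show ?thesis
    by metis
qed

lemma padic_gamma_cong_padic_gamma_nat:
  fixes x :: "'p :: prime_card padic_int"
  assumes "odd CARD('p)" "of_nat n \<equiv>\<^bsub>k\<^esub> x"
  shows "padic_gamma x \<equiv>\<^bsub>k\<^esub> (padic_gamma_nat n :: 'p padic_int)"
  unfolding padic_gamma_def using padic_gamma_nat_cong[OF assms(1)] assms(2)
  by (rule Lim_interpolation_padic_int_cong)

lemma padic_gamma_of_nat:
  assumes "odd CARD('p :: prime_card)"
  shows "padic_gamma (of_nat n :: 'p padic_int) = padic_gamma_nat n"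
  using padic_gamma_cong_padic_gamma_nat[OF assms refl] by (rule padic_int_eqI)

lemma padic_gamma_cong:
  fixes x y :: "'p :: prime_card padic_int"
  assumes "odd CARD('p)" "x \<equiv>\<^bsub>k\<^esub> y"
  shows "padic_gamma x \<equiv>\<^bsub>k\<^esub> padic_gamma y"
proof -
  obtain n where "of_nat n \<equiv>\<^bsub>k\<^esub> x"
    by (rule padic_int_approx_of_nat)
  then show ?thesis
    using assms by (simp add: padic_gamma_cong_padic_gamma_nat[OF assms(1)])
qed

lemma padic_gamma_plus_1:
  fixes x :: "'p :: prime_card padic_int"
  assumes "odd CARD('p)"
  shows "padic_gamma (x + 1) = - (if of_nat CARD('p) dvd x then 1 else x) * padic_gamma x"
proof (rule padic_int_eqI)
  fix k
  obtain n where n: "of_nat n \<equiv>\<^bsub>Suc k\<^esub> x"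
    by (rule padic_int_approx_of_nat)
  have n_cong: "of_nat n \<equiv>\<^bsub>i\<^esub> x" if "i \<le> Suc k" for i
    using n Rep_padic_int_mod[OF that, of x] Rep_padic_int_mod[OF that, of "of_nat n :: 'p padic_int"]
    by simp
  have "of_nat CARD('p) dvd x \<longleftrightarrow> CARD('p) dvd n"
    using n_cong[of 1] padic_int_dvd_iff[of 1 x]
    by (auto simp: Rep_padic_int_of_nat simp flip: zmod_int)
  then have "padic_gamma_nat (Suc n) \<equiv>\<^bsub>k\<^esub> - (if of_nat CARD('p) dvd x then 1 else x) * padic_gamma x"
    using n_cong[of k] padic_gamma_cong_padic_gamma_nat[OF assms n_cong[of k]]
    by (simp add: padic_gamma_nat_Suc times_padic_int.rep_eq uminus_padic_int.rep_eq)
  moreover have "of_nat (Suc n) \<equiv>\<^bsub>k\<^esub> x + 1"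
    using n_cong[of k] by (simp add: plus_padic_int.rep_eq one_padic_int.rep_eq add.commute)
  ultimately show "padic_gamma (x + 1) \<equiv>\<^bsub>k\<^esub> - (if of_nat CARD('p) dvd x then 1 else x) * padic_gamma x"
    using padic_gamma_cong_padic_gamma_nat[OF assms] by metis
qed

lemma padic_gamma_reflection_square:
  fixes x :: "'p :: prime_card padic_int"
  assumes "odd CARD('p)"
  shows "(padic_gamma x * padic_gamma (1 - x))\<^sup>2 = 1"
proof (rule padic_int_eqI)
  have "(padic_gamma (of_nat n) * padic_gamma (1 - of_nat n :: 'p padic_int))\<^sup>2 = 1" for n
  proof (induction n)
    case 0
    show ?case
      using padic_gamma_plus_1[OF assms, of 0] padic_gamma_of_nat[OF assms, of 0]
      by (simp add: padic_gamma_nat_def)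
  next
    case (Suc n)
    let ?x = "of_nat n :: 'p padic_int"
    have "padic_gamma (?x + 1) * padic_gamma (- ?x) = padic_gamma ?x * padic_gamma (1 - ?x) \<or>
        padic_gamma (?x + 1) * padic_gamma (- ?x) = - (padic_gamma ?x * padic_gamma (1 - ?x))"
      using padic_gamma_plus_1[OF assms, of ?x] padic_gamma_plus_1[OF assms, of "- ?x"]
      by (auto simp: add.commute[of 1] simp flip: uminus_add_conv_diff)
    then show ?case
      using Suc by (auto simp: add.commute)
  qed
  moreover fix k
  obtain n where n: "of_nat n \<equiv>\<^bsub>k\<^esub> x"
    by (rule padic_int_approx_of_nat)
  then have one_minus_n: "1 - of_nat n \<equiv>\<^bsub>k\<^esub> 1 - x"
    by (simp add: minus_padic_int.rep_eq)
  ultimately have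
      "(padic_gamma (of_nat n) * padic_gamma (1 - of_nat n :: 'p padic_int))\<^sup>2 \<equiv>\<^bsub>k\<^esub> (1 :: 'p padic_int)"
    by simp
  then show "(padic_gamma x * padic_gamma (1 - x))\<^sup>2 \<equiv>\<^bsub>k\<^esub> (1 :: 'p padic_int)"
    using padic_gamma_cong[OF assms n] padic_gamma_cong[OF assms one_minus_n]
    by (simp add: power2_eq_square times_padic_int.rep_eq)
qed

section \<open>Congruences in the p-adic field\<close>

lemma to_fract_of_nat [simp]: "to_fract (of_nat n) = of_nat n"
  by (induction n) simp_all

lemma to_fract_in_Zp [simp]: "to_fract z \<in> \<int>\<^sub>p"
  by (simp add: padic_integers_def)

lemma Zp_cases:
  assumes "x \<in> \<int>\<^sub>p"
  obtains z where "x = to_fract z"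
  using assms by (auto simp: padic_integers_def)

lemma Zp_0 [simp]: "0 \<in> \<int>\<^sub>p"
  using to_fract_in_Zp[of 0] by simp

lemma Zp_1 [simp]: "1 \<in> \<int>\<^sub>p"
  using to_fract_in_Zp[of 1] by simp

lemma Zp_of_nat [simp]: "of_nat n \<in> \<int>\<^sub>p"
  using to_fract_in_Zp[of "of_nat n"] by simp

lemma Zp_add [simp]: "x \<in> \<int>\<^sub>p \<Longrightarrow> y \<in> \<int>\<^sub>p \<Longrightarrow> x + y \<in> \<int>\<^sub>p"
  by (metis Zp_cases to_fract_add to_fract_in_Zp)

lemma Zp_diff [simp]: "x \<in> \<int>\<^sub>p \<Longrightarrow> y \<in> \<int>\<^sub>p \<Longrightarrow> x - y \<in> \<int>\<^sub>p"
  by (metis Zp_cases to_fract_diff to_fract_in_Zp)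

lemma Zp_uminus [simp]: "x \<in> \<int>\<^sub>p \<Longrightarrow> - x \<in> \<int>\<^sub>p"
  by (metis Zp_cases to_fract_uminus to_fract_in_Zp)

lemma Zp_mult [simp]: "x \<in> \<int>\<^sub>p \<Longrightarrow> y \<in> \<int>\<^sub>p \<Longrightarrow> x * y \<in> \<int>\<^sub>p"
  by (metis Zp_cases to_fract_mult to_fract_in_Zp)

lemma Zp_power [simp]: "x \<in> \<int>\<^sub>p \<Longrightarrow> x ^ n \<in> \<int>\<^sub>p"
  by (induction n) simp_all

lemma Zp_fact [simp]: "fact n \<in> \<int>\<^sub>p"
  by (induction n) simp_all

lemma Zp_sum: "(\<And>i. i \<in> A \<Longrightarrow> f i \<in> \<int>\<^sub>p) \<Longrightarrow> sum f A \<in> \<int>\<^sub>p"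
  by (induction A rule: infinite_finite_induct) simp_all

lemma Zp_pochhammer [simp]: "x \<in> \<int>\<^sub>p \<Longrightarrow> pochhammer x n \<in> \<int>\<^sub>p"
  by (induction n) (simp_all add: pochhammer_Suc)

abbreviation padic_p :: "'p :: prime_card padic" where
  "padic_p \<equiv> of_nat CARD('p)"

notation (input) padic_cong (\<open>(\<open>indent=1\<close>[_ \<equiv> _] '(' mod _'))\<close>)

lemma padic_congI: "x = y + of_nat m * z \<Longrightarrow> y \<in> \<int>\<^sub>p \<Longrightarrow> z \<in> \<int>\<^sub>p \<Longrightarrow> [x \<equiv> y] (mod m)"
  by (auto simp: padic_cong_def)

lemma padic_congE:
  assumes "[x \<equiv> y] (mod m)"
  obtains z where "x = y + of_nat m * z" "y \<in> \<int>\<^sub>p" "z \<in> \<int>\<^sub>p"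
  using assms by (auto simp: padic_cong_def diff_eq_eq add.commute)

lemma padic_cong_in_Zp:
  assumes "[x \<equiv> y] (mod m)"
  shows "x \<in> \<int>\<^sub>p" "y \<in> \<int>\<^sub>p"
  using assms by (auto simp: padic_cong_def)

lemma padic_cong_refl [simp]: "x \<in> \<int>\<^sub>p \<Longrightarrow> [x \<equiv> x] (mod m)"
  by (rule padic_congI[of _ _ _ 0]) auto

lemma padic_cong_sym: "[x \<equiv> y] (mod m) \<Longrightarrow> [y \<equiv> x] (mod m)"
  by (elim padic_congE, rule_tac z = "- z" in padic_congI) auto

lemma padic_cong_trans [trans]: "[x \<equiv> y] (mod m) \<Longrightarrow> [y \<equiv> z] (mod m) \<Longrightarrow> [x \<equiv> z] (mod m)"
  by (elim padic_congE, rule_tac z = "za + zaa" in padic_congI) (auto simp: algebra_simps)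

lemma padic_cong_add:
  assumes "[x \<equiv> y] (mod m)" "[v \<equiv> w] (mod m)"
  shows "[x + v \<equiv> y + w] (mod m)"
proof -
  obtain s t where "x = y + of_nat m * s" "v = w + of_nat m * t" "s \<in> \<int>\<^sub>p" "t \<in> \<int>\<^sub>p" "y \<in> \<int>\<^sub>p" "w \<in> \<int>\<^sub>p"
    using assms by (meson padic_congE)
  then show ?thesis
    by (intro padic_congI[of _ _ _ "s + t"]) (auto simp: algebra_simps)
qed

lemma padic_cong_mult:
  assumes "[x \<equiv> y] (mod m)" "[v \<equiv> w] (mod m)"
  shows "[x * v \<equiv> y * w] (mod m)"
proof -
  obtain s t where "x = y + of_nat m * s" "v = w + of_nat m * t" "s \<in> \<int>\<^sub>p" "t \<in> \<int>\<^sub>p" "y \<in> \<int>\<^sub>p" "w \<in> \<int>\<^sub>p"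
    using assms by (meson padic_congE)
  then show ?thesis
    by (intro padic_congI[of _ _ _ "s * w + y * t + of_nat m * s * t"]) (auto simp: algebra_simps)
qed

lemma padic_cong_uminus: "[x \<equiv> y] (mod m) \<Longrightarrow> [- x \<equiv> - y] (mod m)"
  using padic_cong_mult[of "- 1" "- 1" m x y] by simp

lemma padic_cong_diff: "[x \<equiv> y] (mod m) \<Longrightarrow> [v \<equiv> w] (mod m) \<Longrightarrow> [x - v \<equiv> y - w] (mod m)"
  using padic_cong_add[OF _ padic_cong_uminus] by fastforce

lemma padic_cong_sum: "(\<And>i. i \<in> A \<Longrightarrow> [f i \<equiv> g i] (mod m)) \<Longrightarrow> [sum f A \<equiv> sum g A] (mod m)"
  by (induction A rule: infinite_finite_induct) (simp_all add: padic_cong_add)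

lemma padic_cong_scale:
  assumes "[x \<equiv> y] (mod m)"
  shows "[of_nat n * x \<equiv> of_nat n * y] (mod n * m)"
  using assms by (elim padic_congE, rule_tac z = z in padic_congI) (auto simp: algebra_simps)

lemma padic_cong_dvd_modulus:
  assumes "[x \<equiv> y] (mod m)" "k dvd m"
  shows "[x \<equiv> y] (mod k)"
proof -
  obtain z l where "x = y + of_nat m * z" "y \<in> \<int>\<^sub>p" "z \<in> \<int>\<^sub>p" "m = k * l"
    using assms by (meson padic_congE dvdE)
  then show ?thesis
    by (intro padic_congI[of _ _ _ "of_nat l * z"]) auto
qed

lemma padic_cong_scale_p:
  fixes x y :: "'p :: prime_card padic"
  shows "[x \<equiv> y] (mod CARD('p)) \<Longrightarrow> [padic_p * x \<equiv> padic_p * y] (mod CARD('p)\<^sup>2)"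
  using padic_cong_scale[of x y "CARD('p)" "CARD('p)"] by (simp add: power2_eq_square)

lemma padic_cong_to_fract_iff: "[to_fract x \<equiv> to_fract y] (mod m) \<longleftrightarrow> of_nat m dvd x - y"
proof
  assume "[to_fract x \<equiv> to_fract y] (mod m)"
  then obtain z where "to_fract x = to_fract y + of_nat m * to_fract z"
    by (metis padic_congE Zp_cases)
  then have "to_fract x = to_fract (y + of_nat m * z)"
    by simp
  then show "of_nat m dvd x - y"
    by (simp only: to_fract_eq_iff) simp
next
  assume "of_nat m dvd x - y"
  then obtain z where "x = y + of_nat m * z"
    by (metis dvdE add.commute diff_add_cancel)
  then show "[to_fract x \<equiv> to_fract y] (mod m)"
    by (intro padic_congI[of _ _ _ "to_fract z"]) auto
qed

lemma padic_cong_to_fract_power_iff: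
  fixes x y :: "'p :: prime_card padic_int"
  shows "[to_fract x \<equiv> to_fract y] (mod CARD('p) ^ k) \<longleftrightarrow> x \<equiv>\<^bsub>k\<^esub> y"
  by (simp add: padic_cong_to_fract_iff padic_int_cong_iff_dvd)

lemma padic_cong_of_nat_iff:
  "[of_nat m \<equiv> (of_nat n :: 'p :: prime_card padic)] (mod CARD('p)) \<longleftrightarrow> [m = n] (mod CARD('p))"
  using padic_cong_to_fract_power_iff[of "of_nat m :: 'p padic_int" "of_nat n" 1]
  by (simp add: Rep_padic_int_of_nat cong_def flip: zmod_int)

lemma padic_cong_of_nat_0_iff:
  "[of_nat n \<equiv> (0 :: 'p :: prime_card padic)] (mod CARD('p)) \<longleftrightarrow> CARD('p) dvd n"
  using padic_cong_of_nat_iff[of n 0, where ?'p = 'p] by (simp add: cong_0_iff)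

lemma Zp_approx_of_nat:
  fixes x :: "'p :: prime_card padic"
  assumes "x \<in> \<int>\<^sub>p"
  obtains n where "[x \<equiv> of_nat n] (mod CARD('p) ^ k)"
proof -
  obtain z where z: "x = to_fract z"
    using assms by (rule Zp_cases)
  obtain n where "of_nat n \<equiv>\<^bsub>k\<^esub> z"
    by (rule padic_int_approx_of_nat)
  then have "[x \<equiv> of_nat n] (mod CARD('p) ^ k)"
    using padic_cong_to_fract_power_iff[of z "of_nat n" k] by (simp add: z)
  then show ?thesis
    by (rule that)
qed

definition padic_units :: "'p :: prime_card padic set" where
  "padic_units = {x \<in> \<int>\<^sub>p. x \<noteq> 0 \<and> inverse x \<in> \<int>\<^sub>p}"

lemma padic_unitsD:
  assumes "x \<in> padic_units"
  shows "x \<in> \<int>\<^sub>p" "x \<noteq> 0" "inverse x \<in> \<int>\<^sub>p"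
  using assms by (auto simp: padic_units_def)

lemma padic_units_1 [simp]: "1 \<in> padic_units"
  by (simp add: padic_units_def)

lemma padic_units_mult [simp]: "x \<in> padic_units \<Longrightarrow> y \<in> padic_units \<Longrightarrow> x * y \<in> padic_units"
  by (simp add: padic_units_def)

lemma padic_units_inverse [simp]: "x \<in> padic_units \<Longrightarrow> inverse x \<in> padic_units"
  by (simp add: padic_units_def)

lemma padic_units_uminus [simp]: "x \<in> padic_units \<Longrightarrow> - x \<in> padic_units"
  by (simp add: padic_units_def)

lemma padic_units_divide [simp]: "x \<in> padic_units \<Longrightarrow> y \<in> padic_units \<Longrightarrow> x / y \<in> padic_units"
  by (simp add: divide_inverse)

lemma padic_units_power [simp]: "x \<in> padic_units \<Longrightarrow> x ^ n \<in> padic_units"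
  by (induction n) simp_all

lemma Zp_divide [simp]: "x \<in> \<int>\<^sub>p \<Longrightarrow> y \<in> padic_units \<Longrightarrow> x / y \<in> \<int>\<^sub>p"
  by (simp add: divide_inverse padic_unitsD)

lemma to_fract_in_padic_units:
  assumes "z dvd 1"
  shows "to_fract z \<in> padic_units"
proof -
  obtain y where "1 = z * y"
    using assms by (elim dvdE)
  then have "to_fract z * to_fract y = 1"
    by (metis to_fract_1 to_fract_mult)
  then have "z \<noteq> 0" "inverse (to_fract z) = to_fract y"
    by (auto intro: inverse_unique)
  then show ?thesis
    by (simp add: padic_units_def)
qed

lemma padic_units_if_not_cong_0:
  fixes x :: "'p :: prime_card padic"
  assumes "x \<in> \<int>\<^sub>p" "\<not> [x \<equiv> 0] (mod CARD('p))"
  shows "x \<in> padic_units"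
proof -
  obtain z where z: "x = to_fract z"
    using assms(1) by (rule Zp_cases)
  then have "\<not> of_nat CARD('p) dvd z"
    using assms(2) padic_cong_to_fract_iff[of z 0] by simp
  then show ?thesis
    unfolding z by (intro to_fract_in_padic_units padic_int_unit)
qed

lemma padic_units_not_cong_0:
  fixes x :: "'p :: prime_card padic"
  assumes "x \<in> padic_units"
  shows "\<not> [x \<equiv> 0] (mod CARD('p))"
proof
  assume "[x \<equiv> 0] (mod CARD('p))"
  then have "[inverse x * x \<equiv> inverse x * 0] (mod CARD('p))"
    using assms by (intro padic_cong_mult padic_cong_refl padic_unitsD(3))
  then have "[of_nat 1 \<equiv> (0 :: 'p padic)] (mod CARD('p))"
    using padic_unitsD(2)[OF assms] by simp
  then show False
    unfolding padic_cong_of_nat_0_iff using CARD_prime_card_gt_1[where ?'p = 'p] by simp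
qed

lemma padic_units_cong:
  fixes x y :: "'p :: prime_card padic"
  assumes "[x \<equiv> y] (mod CARD('p))" "y \<in> padic_units"
  shows "x \<in> padic_units"
proof (rule padic_units_if_not_cong_0)
  show "x \<in> \<int>\<^sub>p"
    using assms(1) by (rule padic_cong_in_Zp)
  show "\<not> [x \<equiv> 0] (mod CARD('p))"
    using padic_cong_trans[OF padic_cong_sym[OF assms(1)]] padic_units_not_cong_0[OF assms(2)] by blast
qed

lemma padic_units_1_plus: "a \<in> \<int>\<^sub>p \<Longrightarrow> 1 + padic_p * a \<in> padic_units"
  by (rule padic_units_cong[of _ 1]) (auto intro: padic_congI)

lemma padic_units_of_nat:
  "\<not> CARD('p) dvd n \<Longrightarrow> (of_nat n :: 'p :: prime_card padic) \<in> padic_units"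
  by (simp add: padic_units_if_not_cong_0 padic_cong_of_nat_0_iff)

lemma padic_units_of_nat_less [simp]:
  "0 < n \<Longrightarrow> n < CARD('p) \<Longrightarrow> (of_nat n :: 'p :: prime_card padic) \<in> padic_units"
  by (intro padic_units_of_nat nat_dvd_not_less)

lemma padic_units_fact [simp]:
  "n < CARD('p) \<Longrightarrow> (fact n :: 'p :: prime_card padic) \<in> padic_units"
proof (induction n)
  case (Suc n)
  then show ?case
    using padic_units_of_nat_less[where ?'p = 'p, of "Suc n"] by (simp del: of_nat_Suc)
qed simp

lemma padic_cong_inverse:
  assumes "[x \<equiv> y] (mod m)" "x \<in> padic_units" "y \<in> padic_units"
  shows "[inverse x \<equiv> inverse y] (mod m)"
proof -
  have "[inverse x * y * inverse y \<equiv> inverse x * x * inverse y] (mod m)"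
    using assms by (intro padic_cong_mult padic_cong_refl padic_cong_sym[OF assms(1)] padic_unitsD(3))
  then show ?thesis
    using assms by (simp add: padic_unitsD(2) mult.assoc)
qed

lemma padic_cong_divide_unit:
  "[x \<equiv> y] (mod m) \<Longrightarrow> u \<in> padic_units \<Longrightarrow> [x / u \<equiv> y / u] (mod m)"
  by (simp add: divide_inverse padic_cong_mult padic_unitsD(3))

section \<open>First-order expansions\<close>

definition padic_jet :: "'p :: prime_card padic \<Rightarrow> 'p padic \<Rightarrow> 'p padic \<Rightarrow> bool" where
  "padic_jet x u a \<longleftrightarrow> u \<in> padic_units \<and> a \<in> \<int>\<^sub>p \<and> [x \<equiv> u * (1 + padic_p * a)] (mod CARD('p)\<^sup>2)"

lemma padic_jetD:
  fixes x u a :: "'p :: prime_card padic"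
  assumes "padic_jet x u a"
  shows "u \<in> padic_units" "a \<in> \<int>\<^sub>p" "[x \<equiv> u * (1 + padic_p * a)] (mod CARD('p)\<^sup>2)"
  using assms by (auto simp: padic_jet_def)

lemma padic_jet_const: "u \<in> padic_units \<Longrightarrow> padic_jet u u 0"
  by (simp add: padic_jet_def padic_unitsD)

lemma padic_jet_add: "u \<in> padic_units \<Longrightarrow> a \<in> \<int>\<^sub>p \<Longrightarrow> padic_jet (u + padic_p * a) u (a / u)"
  by (simp add: padic_jet_def padic_unitsD distrib_left)

lemma padic_jet_cong:
  fixes x u a :: "'p :: prime_card padic"
  assumes "padic_jet x u a" "[y \<equiv> x] (mod CARD('p)\<^sup>2)" "[b \<equiv> a] (mod CARD('p))"
  shows "padic_jet y u b"
proof -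
  note u = padic_jetD(1)[OF assms(1)]
  have "[y \<equiv> u * (1 + padic_p * a)] (mod CARD('p)\<^sup>2)"
    using assms(2) padic_jetD(3)[OF assms(1)] by (rule padic_cong_trans)
  also have "[u * (1 + padic_p * a) \<equiv> u * (1 + padic_p * b)] (mod CARD('p)\<^sup>2)"
    using u assms(3)
    by (intro padic_cong_mult padic_cong_add padic_cong_scale_p padic_cong_sym[OF assms(3)])
      (auto simp: padic_unitsD)
  finally show ?thesis
    using u padic_cong_in_Zp[OF assms(3)] by (simp add: padic_jet_def)
qed

lemma padic_jet_slope_cong:
  fixes x u a :: "'p :: prime_card padic"
  assumes "padic_jet x u a" "[b \<equiv> a] (mod CARD('p))"
  shows "padic_jet x u b"
  using assms(1) padic_cong_refl[OF padic_cong_in_Zp(1)[OF padic_jetD(3)[OF assms(1)]]] assms(2)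
  by (rule padic_jet_cong)

lemma padic_jet_coeff_cong:
  fixes x u a :: "'p :: prime_card padic"
  assumes "padic_jet x u a"
  shows "[x \<equiv> u] (mod CARD('p))"
proof -
  note jet = padic_jetD[OF assms]
  have "[x \<equiv> u * (1 + padic_p * a)] (mod CARD('p))"
    using jet(3) by (rule padic_cong_dvd_modulus) simp
  also have "[u * (1 + padic_p * a) \<equiv> u] (mod CARD('p))"
    using jet(1,2) by (intro padic_congI[of _ _ _ "u * a"]) (auto simp: padic_unitsD algebra_simps)
  finally show ?thesis .
qed

lemma padic_jet_unit: "padic_jet x u a \<Longrightarrow> x \<in> padic_units"
  using padic_units_cong[OF padic_jet_coeff_cong] padic_jetD(1) by blast

lemma padic_jet_mult:
  fixes x y :: "'p :: prime_card padic"
  assumes "padic_jet x u a" "padic_jet y v b"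
  shows "padic_jet (x * y) (u * v) (a + b)"
proof -
  note u = padic_jetD[OF assms(1)] and v = padic_jetD[OF assms(2)]
  have "[x * y \<equiv> u * (1 + padic_p * a) * (v * (1 + padic_p * b))] (mod CARD('p)\<^sup>2)"
    using u(3) v(3) by (rule padic_cong_mult)
  also have "[u * (1 + padic_p * a) * (v * (1 + padic_p * b)) \<equiv> u * v * (1 + padic_p * (a + b))]
      (mod CARD('p)\<^sup>2)"
    using u v by (intro padic_congI[of _ _ _ "u * v * (a * b)"])
      (auto simp: padic_unitsD algebra_simps power2_eq_square)
  finally show ?thesis
    using u v by (simp add: padic_jet_def)
qed

lemma padic_jet_inverse:
  fixes x :: "'p :: prime_card padic"
  assumes "padic_jet x u a"
  shows "padic_jet (inverse x) (inverse u) (- a)"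
proof -
  note u = padic_jetD[OF assms]
  have one_plus: "1 + padic_p * a \<in> padic_units"
    using u(2) by (rule padic_units_1_plus)
  have "[inverse x \<equiv> inverse (u * (1 + padic_p * a))] (mod CARD('p)\<^sup>2)"
    using u(1,3) one_plus by (intro padic_cong_inverse padic_jet_unit[OF assms]) auto
  also have "inverse (u * (1 + padic_p * a)) = inverse u * inverse (1 + padic_p * a)"
    by (rule inverse_mult_distrib)
  also have "[inverse u * inverse (1 + padic_p * a) \<equiv> inverse u * (1 + padic_p * - a)] (mod CARD('p)\<^sup>2)"
  proof (intro padic_cong_mult padic_cong_refl)
    have "inverse (1 + padic_p * a) =
        1 + padic_p * - a + of_nat (CARD('p)\<^sup>2) * (a\<^sup>2 * inverse (1 + padic_p * a))"
      using padic_unitsD(2)[OF one_plus] by (simp add: field_simps power2_eq_square)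
    then show "[inverse (1 + padic_p * a) \<equiv> 1 + padic_p * - a] (mod CARD('p)\<^sup>2)"
      by (rule padic_congI) (use u(2) one_plus in \<open>auto simp: padic_unitsD\<close>)
  qed (use u in \<open>simp add: padic_unitsD\<close>)
  finally show ?thesis
    using u by (simp add: padic_jet_def)
qed

lemma padic_jet_divide:
  "padic_jet x u a \<Longrightarrow> padic_jet y v b \<Longrightarrow> padic_jet (x / y) (u / v) (a - b)"
  using padic_jet_mult[OF _ padic_jet_inverse] by (fastforce simp: divide_inverse)

lemma padic_jet_trans:
  fixes x :: "'p :: prime_card padic"
  assumes "padic_jet x u a" "padic_jet u v b"
  shows "padic_jet x v (a + b)"
proof (rule padic_jet_cong)
  have "padic_jet (1 + padic_p * a) 1 a"
    using padic_jet_add[of 1 a] padic_jetD(2)[OF assms(1)] by simp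
  then show "padic_jet (u * (1 + padic_p * a)) v (a + b)"
    using padic_jet_mult[OF assms(2)] by (fastforce simp: add.commute)
  show "[a + b \<equiv> a + b] (mod CARD('p))"
    using padic_jetD(2)[OF assms(1)] padic_jetD(2)[OF assms(2)] by simp
qed (rule padic_jetD(3)[OF assms(1)])

lemma padic_jet_diff_cong:
  fixes x y :: "'p :: prime_card padic"
  assumes "padic_jet x u a" "padic_jet y u b"
  shows "[x - y \<equiv> padic_p * (u * (a - b))] (mod CARD('p)\<^sup>2)"
  using padic_cong_diff[OF padic_jetD(3)[OF assms(1)] padic_jetD(3)[OF assms(2)]]
  by (simp add: algebra_simps)

section \<open>Harmonic numbers modulo p\<close>

definition harmonic :: "nat \<Rightarrow> 'a :: field" where
  "harmonic n = (\<Sum>i = 1..n. 1 / of_nat i)"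

lemma harmonic_0 [simp]: "harmonic 0 = 0"
  by (simp add: harmonic_def)

lemma harmonic_Suc: "harmonic (Suc n) = harmonic n + 1 / of_nat (Suc n)"
  by (simp add: harmonic_def)

lemma Zp_harmonic [simp]: "n < CARD('p) \<Longrightarrow> (harmonic n :: 'p :: prime_card padic) \<in> \<int>\<^sub>p"
  unfolding harmonic_def by (intro Zp_sum Zp_divide) auto

lemma recip_p_minus_cong:
  assumes "0 < n" "n < CARD('p :: prime_card)"
  shows "[1 / of_nat (CARD('p) - n) \<equiv> - (1 / of_nat n :: 'p padic)] (mod CARD('p))"
proof -
  have "[of_nat (CARD('p) - n) \<equiv> (- of_nat n :: 'p padic)] (mod CARD('p))"
    using assms by (intro padic_congI[of _ _ _ 1]) (auto simp: of_nat_diff)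
  then have "[inverse (of_nat (CARD('p) - n)) \<equiv> inverse (- of_nat n :: 'p padic)] (mod CARD('p))"
    using assms by (intro padic_cong_inverse padic_units_uminus padic_units_of_nat_less) auto
  then show ?thesis
    by (simp add: divide_inverse)
qed

lemma harmonic_p_minus_1_minus:
  assumes "n < CARD('p :: prime_card)"
  shows "[harmonic (CARD('p) - 1 - n) \<equiv> harmonic (CARD('p) - 1) + (harmonic n :: 'p padic)]
      (mod CARD('p))"
  using assms
proof (induction n)
  case 0
  then show ?case by simp
next
  case (Suc n)
  have "CARD('p) - 1 - n = Suc (CARD('p) - 1 - Suc n)" "Suc (CARD('p) - 1 - Suc n) = CARD('p) - Suc n"
    using Suc.prems by auto
  then have "harmonic (CARD('p) - 1 - Suc n) =
      harmonic (CARD('p) - 1 - n) - (1 / of_nat (CARD('p) - Suc n) :: 'p padic)"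
    by (metis add_diff_cancel_right' harmonic_Suc)
  also have "[harmonic (CARD('p) - 1 - n) - 1 / of_nat (CARD('p) - Suc n) \<equiv>
      harmonic (CARD('p) - 1) + (harmonic n :: 'p padic) - - (1 / of_nat (Suc n))] (mod CARD('p))"
    using Suc by (intro padic_cong_diff recip_p_minus_cong) auto
  finally show ?case
    by (simp add: harmonic_Suc add.assoc)
qed

lemma harmonic_p_minus_1_cong_0:
  assumes "odd CARD('p :: prime_card)"
  shows "[harmonic (CARD('p) - 1) \<equiv> (0 :: 'p padic)] (mod CARD('p))"
proof -
  let ?H = "harmonic (CARD('p) - 1) :: 'p padic"
  have p: "prime CARD('p)"
    by (rule prime_card)
  have "\<not> CARD('p) dvd 2"
    using assms p primes_dvd_imp_eq[OF p two_is_prime_nat] by auto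
  then have two: "(of_nat 2 :: 'p padic) \<in> padic_units"
    by (rule padic_units_of_nat)
  have "[0 \<equiv> ?H + ?H] (mod CARD('p))"
    using harmonic_p_minus_1_minus[where ?'p = 'p, of "CARD('p) - 1"] by simp
  then have "[0 / of_nat 2 \<equiv> (?H + ?H) / of_nat 2] (mod CARD('p))"
    using two by (rule padic_cong_divide_unit)
  then show ?thesis
    by (simp add: padic_cong_sym)
qed

lemma harmonic_reflect:
  assumes "odd CARD('p :: prime_card)" "n < CARD('p)"
  shows "[harmonic (CARD('p) - 1 - n) \<equiv> (harmonic n :: 'p padic)] (mod CARD('p))"
proof -
  have "[harmonic (CARD('p) - 1 - n) \<equiv> harmonic (CARD('p) - 1) + (harmonic n :: 'p padic)]
      (mod CARD('p))"
    using assms(2) by (rule harmonic_p_minus_1_minus)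
  also have "[harmonic (CARD('p) - 1) + (harmonic n :: 'p padic) \<equiv> 0 + harmonic n] (mod CARD('p))"
    using assms by (intro padic_cong_add harmonic_p_minus_1_cong_0 padic_cong_refl Zp_harmonic)
  finally show ?thesis
    by simp
qed

section \<open>The gamma function modulo the square of p\<close>

definition Gamma_p :: "'p :: prime_card padic \<Rightarrow> 'p padic" (\<open>\<Gamma>\<^sub>p\<close>) where
  "\<Gamma>\<^sub>p x = to_fract (padic_gamma (THE z. to_fract z = x))"

lemma Gamma_p_to_fract: "\<Gamma>\<^sub>p (to_fract z) = to_fract (padic_gamma z)"
  by (simp add: Gamma_p_def)

lemma padic_gamma_rat_eq_Gamma_p: "padic_gamma_rat q = \<Gamma>\<^sub>p (of_rat q)"
  by (simp add: padic_gamma_rat_def padic_int_of_rat_def Gamma_p_def)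

lemma Gamma_p_cong:
  fixes x y :: "'p :: prime_card padic"
  assumes "odd CARD('p)" "[x \<equiv> y] (mod CARD('p) ^ k)"
  shows "[\<Gamma>\<^sub>p x \<equiv> \<Gamma>\<^sub>p y] (mod CARD('p) ^ k)"
proof -
  obtain z w where "x = to_fract z" "y = to_fract w"
    using padic_cong_in_Zp[OF assms(2)] by (meson Zp_cases)
  then show ?thesis
    using assms(2) padic_gamma_cong[OF assms(1), of z k w]
    by (simp add: Gamma_p_to_fract padic_cong_to_fract_power_iff)
qed

lemma Gamma_p_0:
  assumes "odd CARD('p :: prime_card)"
  shows "\<Gamma>\<^sub>p 0 = (1 :: 'p padic)"
  using Gamma_p_to_fract[of "0 :: 'p padic_int"] padic_gamma_of_nat[OF assms, of 0]
  by (simp add: padic_gamma_nat_def)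

lemma Gamma_p_plus_1:
  fixes x :: "'p :: prime_card padic"
  assumes "odd CARD('p)" "x \<in> \<int>\<^sub>p"
  shows "\<Gamma>\<^sub>p (x + 1) = - (if [x \<equiv> 0] (mod CARD('p)) then 1 else x) * \<Gamma>\<^sub>p x"
proof -
  obtain z where z: "x = to_fract z"
    using assms(2) by (rule Zp_cases)
  have "[x \<equiv> 0] (mod CARD('p)) \<longleftrightarrow> of_nat CARD('p) dvd z"
    using padic_cong_to_fract_iff[of z 0] by (simp add: z)
  moreover have "\<Gamma>\<^sub>p (x + 1) = to_fract (padic_gamma (z + 1))"
    using Gamma_p_to_fract[of "z + 1"] by (simp add: z)
  ultimately show ?thesis
    by (simp add: z Gamma_p_to_fract padic_gamma_plus_1[OF assms(1)])
qed

lemma Gamma_p_plus_1_unit: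
  assumes "odd CARD('p :: prime_card)" "x \<in> (padic_units :: 'p padic set)"
  shows "\<Gamma>\<^sub>p (x + 1) = - x * \<Gamma>\<^sub>p x"
  using Gamma_p_plus_1[OF assms(1) padic_unitsD(1)[OF assms(2)]] padic_units_not_cong_0[OF assms(2)]
  by simp

lemma Gamma_p_reflection_square:
  fixes x :: "'p :: prime_card padic"
  assumes "odd CARD('p)" "x \<in> \<int>\<^sub>p"
  shows "(\<Gamma>\<^sub>p x * \<Gamma>\<^sub>p (1 - x))\<^sup>2 = 1"
proof -
  obtain z where z: "x = to_fract z"
    using assms(2) by (rule Zp_cases)
  then have "\<Gamma>\<^sub>p (1 - x) = to_fract (padic_gamma (1 - z))"
    using Gamma_p_to_fract[of "1 - z"] by simp
  then have "(\<Gamma>\<^sub>p x * \<Gamma>\<^sub>p (1 - x))\<^sup>2 = to_fract ((padic_gamma z * padic_gamma (1 - z))\<^sup>2)"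
    by (simp add: z Gamma_p_to_fract power2_eq_square)
  then show ?thesis
    by (simp only: padic_gamma_reflection_square[OF assms(1)] to_fract_1)
qed

lemma Gamma_p_unit:
  fixes x :: "'p :: prime_card padic"
  assumes "odd CARD('p)" "x \<in> \<int>\<^sub>p"
  shows "\<Gamma>\<^sub>p x \<in> padic_units"
proof -
  obtain z where z: "x = to_fract z"
    using assms(2) by (rule Zp_cases)
  have "1 = padic_gamma z * (padic_gamma z * padic_gamma (1 - z) ^ 2)"
    using padic_gamma_reflection_square[OF assms(1), of z] by (simp add: power2_eq_square ac_simps)
  then have "padic_gamma z dvd 1"
    by (rule dvdI)
  then show ?thesis
    unfolding z Gamma_p_to_fract by (rule to_fract_in_padic_units)
qed

text \<open>
  Minus the Wilson quotient. Modulo \<open>p\<close> it is the logarithmic derivative of \<open>\<Gamma>\<^sub>p\<close> at \<open>0\<close>, which the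
  functional equation shifts by harmonic numbers at the other residue classes.
\<close>

definition Gamma_p_slope :: "'p :: prime_card padic" where
  "Gamma_p_slope = - (fact (CARD('p) - 1) + 1) / padic_p"

lemma Gamma_p_slope_in_Zp [simp]: "(Gamma_p_slope :: 'p :: prime_card padic) \<in> \<int>\<^sub>p"
proof -
  have "[fact (CARD('p) - 1) = - 1] (mod int CARD('p))"
    by (rule wilson_theorem) (rule prime_card)
  then have "int CARD('p) dvd int (fact (CARD('p) - 1) + 1)"
    by (simp add: cong_iff_dvd_diff add.commute)
  then have "CARD('p) dvd fact (CARD('p) - 1) + 1"
    by (simp only: of_nat_dvd_iff)
  then obtain k where "fact (CARD('p) - 1) + 1 = CARD('p) * k"
    by (elim dvdE)
  from arg_cong[OF this, of "of_nat :: nat \<Rightarrow> 'p padic"]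
  have "fact (CARD('p) - 1) + 1 = padic_p * (of_nat k :: 'p padic)"
    by (simp add: add.commute)
  then have "Gamma_p_slope = (- of_nat k :: 'p padic)"
    unfolding Gamma_p_slope_def by (simp only:) simp
  then show ?thesis
    by (metis Zp_of_nat Zp_uminus)
qed

lemma Gamma_p_jet_pos_if_jet_multiple:
  fixes y :: "'p :: prime_card padic"
  assumes "odd CARD('p)" "y \<in> \<int>\<^sub>p" "n < CARD('p)"
    and multiple: "padic_jet (\<Gamma>\<^sub>p (padic_p * y)) 1 (y * Gamma_p_slope)"
  shows "padic_jet (\<Gamma>\<^sub>p (of_nat (Suc n) + padic_p * y)) ((- 1) ^ Suc n * fact n)
      (y * (Gamma_p_slope + harmonic n))"
  using assms(3)
proof (induction n)
  case 0
  have "[padic_p * y \<equiv> 0] (mod CARD('p))"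
    using assms(2) by (intro padic_congI) auto
  then have "\<Gamma>\<^sub>p (of_nat (Suc 0) + padic_p * y) = - 1 * \<Gamma>\<^sub>p (padic_p * y)"
    using Gamma_p_plus_1[OF assms(1), of "padic_p * y"] assms(2) by (simp add: add.commute)
  then show ?case
    using padic_jet_mult[OF padic_jet_const[of "- 1"] multiple] by simp
next
  case (Suc n)
  let ?x = "of_nat (Suc n) + padic_p * y"
  have unit: "(of_nat (Suc n) :: 'p padic) \<in> padic_units"
    using Suc.prems by (intro padic_units_of_nat_less) auto
  have jet: "padic_jet (- ?x) (- of_nat (Suc n)) (- y / - of_nat (Suc n))"
    using padic_jet_add[of "- of_nat (Suc n)" "- y"] unit assms(2)
    by (simp add: algebra_simps del: of_nat_Suc)
  have "?x \<in> padic_units"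
    using padic_units_uminus[OF padic_jet_unit[OF jet]] by (simp only: minus_minus)
  with assms(1) have "\<Gamma>\<^sub>p (?x + 1) = - ?x * \<Gamma>\<^sub>p ?x"
    by (rule Gamma_p_plus_1_unit)
  moreover have "padic_jet (- ?x * \<Gamma>\<^sub>p ?x) (- of_nat (Suc n) * ((- 1) ^ Suc n * fact n))
      (- y / - of_nat (Suc n) + y * (Gamma_p_slope + harmonic n))"
    using jet Suc by (intro padic_jet_mult) auto
  moreover have "- of_nat (Suc n) * ((- 1) ^ Suc n * fact n) =
      (- 1) ^ Suc (Suc n) * (fact (Suc n) :: 'p padic)"
    by (simp add: algebra_simps)
  moreover have "- y / - of_nat (Suc n) + y * (Gamma_p_slope + harmonic n) =
      y * (Gamma_p_slope + harmonic (Suc n))"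
    by (simp add: harmonic_Suc algebra_simps del: of_nat_Suc)
  moreover have "?x + 1 = of_nat (Suc (Suc n)) + padic_p * y"
    by simp
  ultimately show ?case
    by metis
qed

lemma Gamma_p_jet_multiple_of_nat:
  assumes odd: "odd CARD('p :: prime_card)"
  shows "padic_jet (\<Gamma>\<^sub>p (padic_p * of_nat m)) 1 (of_nat m * (Gamma_p_slope :: 'p padic))"
proof (induction m)
  case 0
  show ?case
    using Gamma_p_0[OF odd] by (simp add: padic_jet_const)
next
  case (Suc m)
  let ?g = "Gamma_p_slope :: 'p padic"
  have "(- 1) ^ CARD('p) * fact (CARD('p) - 1) = (1 + padic_p * ?g)"
    using odd by (simp add: Gamma_p_slope_def)
  then have "padic_jet ((- 1) ^ CARD('p) * fact (CARD('p) - 1)) 1 ?g"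
    using padic_jet_add[of 1 ?g] by simp
  moreover have "padic_jet (\<Gamma>\<^sub>p (padic_p + padic_p * of_nat m)) ((- 1) ^ CARD('p) * fact (CARD('p) - 1))
      (of_nat m * (?g + harmonic (CARD('p) - 1)))"
    using Gamma_p_jet_pos_if_jet_multiple[OF odd _ _ Suc, of "CARD('p) - 1"] by simp
  ultimately have "padic_jet (\<Gamma>\<^sub>p (padic_p + padic_p * of_nat m)) 1
      (of_nat m * (?g + harmonic (CARD('p) - 1)) + ?g)"
    by (rule padic_jet_trans[rotated])
  moreover have "[of_nat m * (?g + 0) + ?g \<equiv> of_nat m * (?g + harmonic (CARD('p) - 1)) + ?g]
      (mod CARD('p))"
    by (intro padic_cong_add padic_cong_mult padic_cong_refl
        padic_cong_sym[OF harmonic_p_minus_1_cong_0] odd) auto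
  ultimately have "padic_jet (\<Gamma>\<^sub>p (padic_p + padic_p * of_nat m)) 1 (of_nat m * (?g + 0) + ?g)"
    by (rule padic_jet_slope_cong)
  then show ?case
    by (simp add: algebra_simps)
qed

lemma Gamma_p_jet_multiple:
  fixes y :: "'p :: prime_card padic"
  assumes "odd CARD('p)" "y \<in> \<int>\<^sub>p"
  shows "padic_jet (\<Gamma>\<^sub>p (padic_p * y)) 1 (y * Gamma_p_slope)"
proof -
  obtain m where "[y \<equiv> of_nat m] (mod CARD('p) ^ 1)"
    using assms(2) by (rule Zp_approx_of_nat)
  then have y: "[y \<equiv> of_nat m] (mod CARD('p))"
    by simp
  show ?thesis
  proof (rule padic_jet_cong[OF Gamma_p_jet_multiple_of_nat[OF assms(1)]])
    show "[\<Gamma>\<^sub>p (padic_p * y) \<equiv> \<Gamma>\<^sub>p (padic_p * of_nat m)] (mod CARD('p)\<^sup>2)"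
      using y by (intro Gamma_p_cong assms padic_cong_scale_p)
    show "[y * Gamma_p_slope \<equiv> of_nat m * Gamma_p_slope] (mod CARD('p))"
      using y by (intro padic_cong_mult padic_cong_refl) auto
  qed
qed

lemma Gamma_p_jet_pos:
  fixes y :: "'p :: prime_card padic"
  assumes "odd CARD('p)" "y \<in> \<int>\<^sub>p" "n < CARD('p)"
  shows "padic_jet (\<Gamma>\<^sub>p (of_nat (Suc n) + padic_p * y)) ((- 1) ^ Suc n * fact n)
      (y * (Gamma_p_slope + harmonic n))"
  using Gamma_p_jet_pos_if_jet_multiple Gamma_p_jet_multiple assms by blast

lemma Gamma_p_jet_neg:
  fixes y :: "'p :: prime_card padic"
  assumes "odd CARD('p)" "y \<in> \<int>\<^sub>p" "n < CARD('p)"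
  shows "padic_jet (\<Gamma>\<^sub>p (- of_nat n + padic_p * y)) (1 / fact n) (y * (Gamma_p_slope + harmonic n))"
  using assms(3)
proof (induction n)
  case 0
  show ?case
    using Gamma_p_jet_multiple[OF assms(1,2)] by simp
next
  case (Suc n)
  let ?x = "- of_nat (Suc n) + padic_p * y"
  have unit: "(of_nat (Suc n) :: 'p padic) \<in> padic_units"
    using Suc.prems by (intro padic_units_of_nat_less) auto
  have jet: "padic_jet (- ?x) (of_nat (Suc n)) (- y / of_nat (Suc n))"
    using padic_jet_add[of "of_nat (Suc n)" "- y"] unit assms(2)
    by (simp add: algebra_simps del: of_nat_Suc)
  have x_unit: "?x \<in> padic_units"
    using padic_units_uminus[OF padic_jet_unit[OF jet]] by (simp only: minus_minus)
  with assms(1) have "\<Gamma>\<^sub>p (?x + 1) = - ?x * \<Gamma>\<^sub>p ?x"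
    by (rule Gamma_p_plus_1_unit)
  moreover have "?x + 1 = - of_nat n + padic_p * y"
    by simp
  ultimately have "\<Gamma>\<^sub>p ?x = \<Gamma>\<^sub>p (- of_nat n + padic_p * y) / - ?x"
    using padic_unitsD(2)[OF x_unit] by (simp add: field_simps)
  moreover have "padic_jet (\<Gamma>\<^sub>p (- of_nat n + padic_p * y) / - ?x) (1 / fact n / of_nat (Suc n))
      (y * (Gamma_p_slope + harmonic n) - - y / of_nat (Suc n))"
    using jet Suc by (intro padic_jet_divide) auto
  moreover have "1 / fact n / of_nat (Suc n) = (1 / fact (Suc n) :: 'p padic)"
    by (simp add: mult.commute)
  moreover have "y * (Gamma_p_slope + harmonic n) - - y / of_nat (Suc n) =
      y * (Gamma_p_slope + harmonic (Suc n))"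
    by (simp add: harmonic_Suc algebra_simps del: of_nat_Suc)
  ultimately show ?case
    by metis
qed

section \<open>A partial fraction expansion and its harmonic sums\<close>

definition partial_fraction_coeff :: "('i \<Rightarrow> 'a :: field) \<Rightarrow> ('i \<Rightarrow> 'a) \<Rightarrow> 'i set \<Rightarrow> 'i \<Rightarrow> 'a" where
  "partial_fraction_coeff z c A i = (c i - z i) * (\<Prod>k\<in>A - {i}. (c i - z k) / (c i - c k))"

lemma partial_fraction_coeff_insert:
  assumes "finite A" "a \<notin> A" "i \<in> A"
  shows "partial_fraction_coeff z c (insert a A) i =
      partial_fraction_coeff z c A i * ((c i - z a) / (c i - c a))"
proof -
  have "insert a A - {i} = insert a (A - {i})"
    using assms by auto
  then show ?thesis
    using assms by (simp add: partial_fraction_coeff_def)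
qed

lemma partial_fraction_coeff_times_factor:
  fixes x :: "'a :: field"
  assumes "finite A" "a \<notin> A" "i \<in> A" "x \<noteq> c i" "x \<noteq> c a" "c a \<noteq> c i"
  shows "partial_fraction_coeff z c A i / (x - c i) * ((x - z a) / (x - c a)) =
    partial_fraction_coeff z c (insert a A) i / (x - c i) +
    (c a - z a) / (x - c a) * (partial_fraction_coeff z c A i / (c a - c i))"
proof -
  define t u v where "t = c a - z a" and "u = x - c i" and "v = c a - c i"
  have "u \<noteq> 0" "v \<noteq> 0" "u - v \<noteq> 0"
    using assms by (auto simp: u_def v_def)
  moreover have "x - c a = u - v" "c i - c a = - v" "x - z a = u - v + t" "c i - z a = t - v"
    by (simp_all add: t_def u_def v_def)
  ultimately show ?thesis
    unfolding partial_fraction_coeff_insert[OF assms(1-3)] t_def[symmetric] u_def[symmetric]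
        v_def[symmetric]
    by (simp add: divide_simps) (simp add: algebra_simps)
qed

lemma partial_fraction_prod:
  fixes x :: "'a :: field"
  assumes "finite A" "inj_on c A" "\<And>i. i \<in> A \<Longrightarrow> x \<noteq> c i"
  shows "(\<Prod>i\<in>A. (x - z i) / (x - c i)) = 1 + (\<Sum>i\<in>A. partial_fraction_coeff z c A i / (x - c i))"
  using assms
proof (induction A arbitrary: x rule: finite_induct)
  case empty
  then show ?case by simp
next
  case (insert a A)
  let ?\<rho> = "partial_fraction_coeff z c A" and ?t = "c a - z a"
  have "partial_fraction_coeff z c (insert a A) a = ?t * (\<Prod>k\<in>A. (c a - z k) / (c a - c k))"
    using insert.hyps by (simp add: partial_fraction_coeff_def)
  also have "\<dots> = ?t * (1 + (\<Sum>i\<in>A. ?\<rho> i / (c a - c i)))"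
    using insert by (subst insert.IH) (auto simp: inj_on_def)
  finally have "partial_fraction_coeff z c (insert a A) a / (x - c a) =
      ?t / (x - c a) * (1 + (\<Sum>i\<in>A. ?\<rho> i / (c a - c i)))"
    by simp
  also have "\<dots> = ?t / (x - c a) + (\<Sum>i\<in>A. ?t / (x - c a) * (?\<rho> i / (c a - c i)))"
    by (simp only: distrib_left mult_1_right sum_distrib_left)
  finally have coeff_a: "partial_fraction_coeff z c (insert a A) a / (x - c a) = \<dots>" .
  have "(\<Prod>i\<in>insert a A. (x - z i) / (x - c i)) =
      (1 + (\<Sum>i\<in>A. ?\<rho> i / (x - c i))) * ((x - z a) / (x - c a))"
    using insert by simp
  also have "\<dots> = (x - z a) / (x - c a) + (\<Sum>i\<in>A. ?\<rho> i / (x - c i) * ((x - z a) / (x - c a)))"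
    by (simp only: distrib_right sum_distrib_right mult_1_left)
  also have "(\<Sum>i\<in>A. ?\<rho> i / (x - c i) * ((x - z a) / (x - c a))) =
      (\<Sum>i\<in>A. partial_fraction_coeff z c (insert a A) i / (x - c i)) +
      (\<Sum>i\<in>A. ?t / (x - c a) * (?\<rho> i / (c a - c i)))"
    unfolding sum.distrib[symmetric] using insert
    by (intro sum.cong refl partial_fraction_coeff_times_factor) (auto simp: inj_on_def)
  finally have expand: "(\<Prod>i\<in>insert a A. (x - z i) / (x - c i)) = (x - z a) / (x - c a) + \<dots>" .
  have "(x - z a) / (x - c a) = 1 + ?t / (x - c a)"
    using insert.prems by (simp add: field_simps)
  then show ?case
    unfolding expand using insert.hyps coeff_a by simp
qed

text \<open>The coefficients of the shifted Legendre polynomial \<open>P\<^sub>r(1 - 2 x)\<close>.\<close>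

definition legendre_coeff :: "nat \<Rightarrow> nat \<Rightarrow> 'a :: field_char_0" where
  "legendre_coeff r j = (- 1) ^ j * of_nat ((r choose j) * ((r + j) choose j))"

lemma legendre_coeff_0 [simp]: "legendre_coeff r 0 = 1"
  by (simp add: legendre_coeff_def)

lemma legendre_coeff_fact:
  assumes "j \<le> r"
  shows "legendre_coeff r j = (- 1) ^ j * fact (r + j) / (fact (r - j) * fact j ^ 2)"
  using assms by (simp add: legendre_coeff_def binomial_fact power2_eq_square)

text \<open>
  The logarithmic derivative in \<open>j\<close> of \<open>\<Gamma>(r + j + 1) / (\<Gamma>(r - j + 1) \<Gamma>(j + 1)\<^sup>2)\<close>, the absolute value of
  the Legendre coefficient.
\<close>

definition legendre_log_deriv :: "nat \<Rightarrow> nat \<Rightarrow> 'a :: field" where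
  "legendre_log_deriv r j = harmonic (r - j) + harmonic (r + j) - 2 * harmonic j"

definition reflection_ratio :: "nat \<Rightarrow> 'a :: field_char_0 \<Rightarrow> 'a" where
  "reflection_ratio r x = (\<Prod>i = 1..r. (x + of_nat i) / (x - of_nat i))"

lemma prod_of_nat_add: "(\<Prod>k = 1..r. of_nat n + of_nat k) = (fact (n + r) / fact n :: 'a :: field_char_0)"
  by (induction r) (simp_all add: algebra_simps)

lemma prod_of_nat_diff:
  assumes "r < n"
  shows "(\<Prod>k = 1..r. of_nat n - of_nat k) = (fact (n - 1) / fact (n - 1 - r) :: 'a :: field_char_0)"
  using assms
proof (induction r)
  case (Suc r)
  then have "n - 1 - r = Suc (n - 1 - Suc r)"
    by simp
  moreover from this have "of_nat n - of_nat (Suc r) = (of_nat (Suc (n - 1 - Suc r)) :: 'a)"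
    using Suc.prems by (simp add: of_nat_diff)
  ultimately show ?case
    using Suc by (simp del: of_nat_Suc)
qed simp

lemma prod_of_nat_diff_greater:
  assumes "n \<le> r"
  shows "(\<Prod>k = Suc n..r. of_nat n - of_nat k) = ((- 1) ^ (r - n) * fact (r - n) :: 'a :: field_char_0)"
  using assms
proof (induction r rule: dec_induct)
  case (step r)
  then have "of_nat n - of_nat (Suc r) = (- of_nat (Suc (r - n)) :: 'a)"
    by (simp add: of_nat_diff)
  then show ?case
    using step by (simp add: Suc_diff_le del: of_nat_Suc)
qed simp

lemma reflection_ratio_of_nat:
  assumes "r < n"
  shows "reflection_ratio r (of_nat n) =
    (fact (n + r) * fact (n - 1 - r) / (fact n * fact (n - 1)) :: 'a :: field_char_0)"
  unfolding reflection_ratio_def prod_dividef prod_of_nat_add prod_of_nat_diff[OF assms] by simp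

lemma reflection_ratio_residue:
  assumes "i \<in> {1..r}"
  shows "partial_fraction_coeff (\<lambda>k. - of_nat k) of_nat {1..r} i =
    (- 1) ^ r * (of_nat i * legendre_coeff r i :: 'a :: field_char_0)"
proof -
  have "(\<Prod>k\<in>{1..r} - {i}. of_nat i - of_nat k :: 'a) =
      (\<Prod>k = 1..i - 1. of_nat i - of_nat k) * (\<Prod>k = Suc i..r. of_nat i - of_nat k)"
    using assms by (subst prod.union_disjoint[symmetric]) (auto intro!: prod.cong)
  also have "\<dots> = fact (i - 1) * ((- 1) ^ (r - i) * fact (r - i))"
    using assms prod_of_nat_diff[of "i - 1" i, where ?'a = 'a]
        prod_of_nat_diff_greater[of i r, where ?'a = 'a]
    by simp
  finally have denominator: "(\<Prod>k\<in>{1..r} - {i}. of_nat i - of_nat k :: 'a) = \<dots>" .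
  have "2 * of_nat i * (\<Prod>k\<in>{1..r} - {i}. of_nat i + of_nat k :: 'a) = (\<Prod>k = 1..r. of_nat i + of_nat k)"
    using assms by (simp add: prod.remove)
  also have "\<dots> = fact (i + r) / fact i"
    by (rule prod_of_nat_add)
  finally have numerator: "2 * of_nat i * (\<Prod>k\<in>{1..r} - {i}. of_nat i + of_nat k :: 'a) = \<dots>" .
  have "partial_fraction_coeff (\<lambda>k. - of_nat k) of_nat {1..r} i =
      2 * of_nat i * (\<Prod>k\<in>{1..r} - {i}. of_nat i + of_nat k) /
          (\<Prod>k\<in>{1..r} - {i}. of_nat i - of_nat k :: 'a)"
    by (simp add: partial_fraction_coeff_def prod_dividef)
  also have "\<dots> = fact (i + r) / fact i / (fact (i - 1) * ((- 1) ^ (r - i) * fact (r - i)))"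
    by (simp only: numerator denominator)
  also have "\<dots> = (- 1) ^ r * (of_nat i * legendre_coeff r i)"
  proof -
    obtain k m where "i = Suc k" "r = i + m"
      using assms by (metis atLeastAtMost_iff le_Suc_ex Suc_le_D One_nat_def)
    then show ?thesis
      by (cases "even k"; cases "even m")
        (simp_all add: legendre_coeff_fact power2_eq_square add.commute del: of_nat_Suc fact_Suc,
         simp_all add: fact_Suc[of k] del: of_nat_Suc)
  qed
  finally show ?thesis .
qed

lemma reflection_ratio_partial_fraction:
  fixes x :: "'a :: field_char_0"
  assumes "\<And>i. i \<in> {1..r} \<Longrightarrow> x \<noteq> of_nat i"
  shows "reflection_ratio r x =
      1 + (- 1) ^ r * (\<Sum>i = 1..r. of_nat i * legendre_coeff r i / (x - of_nat i))"
proof -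
  have "reflection_ratio r x = (\<Prod>i = 1..r. (x - - of_nat i) / (x - of_nat i))"
    by (simp add: reflection_ratio_def)
  also have "\<dots> =
      1 + (\<Sum>i = 1..r. partial_fraction_coeff (\<lambda>k. - of_nat k) of_nat {1..r} i / (x - of_nat i))"
    using assms by (intro partial_fraction_prod) (auto simp: inj_on_def)
  also have "(\<Sum>i = 1..r. partial_fraction_coeff (\<lambda>k. - of_nat k) of_nat {1..r} i / (x - of_nat i)) =
      (\<Sum>i = 1..r. (- 1) ^ r * (of_nat i * legendre_coeff r i) / (x - of_nat i))"
    by (intro sum.cong refl) (simp only: reflection_ratio_residue)
  finally show ?thesis
    by (simp add: sum_distrib_left)
qed

lemma sum_legendre_coeff: "(\<Sum>j = 0..r. legendre_coeff r j) = ((- 1) ^ r :: 'a :: field_char_0)"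
proof -
  let ?S = "\<Sum>i = 1..r. legendre_coeff r i :: 'a"
  have "(- 1) ^ r = reflection_ratio r (0 :: 'a)"
    by (simp add: reflection_ratio_def)
  also have "\<dots> = 1 - (- 1) ^ r * ?S"
    by (subst reflection_ratio_partial_fraction) (auto simp: sum_negf)
  finally have "(- 1) ^ r * (- 1) ^ r = (- 1) ^ r * (1 - (- 1) ^ r * ?S)"
    by simp
  then have "(- 1) ^ r - ?S = 1"
    by (simp add: right_diff_distrib flip: power_mult_distrib mult.assoc)
  then have "1 + ?S = (- 1) ^ r"
    by (simp add: diff_eq_eq)
  then show ?thesis
    by (simp add: sum.atLeast_Suc_atMost)
qed

lemma sum_legendre_coeff_divide_add:
  assumes "l \<in> {1..r}"
  shows "(\<Sum>i = 1..r. of_nat i * legendre_coeff r i / (of_nat i + of_nat l)) =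
      ((- 1) ^ r :: 'a :: field_char_0)"
    (is "?S = _")
proof -
  have "- of_nat l - of_nat i = - (of_nat i + of_nat l :: 'a)" for i
    by simp
  then have "(\<Sum>i = 1..r. of_nat i * legendre_coeff r i / (- of_nat l - of_nat i)) = - ?S"
    by (simp only: divide_minus_right sum_negf)
  moreover have "reflection_ratio r (- of_nat l :: 'a) = 0"
    unfolding reflection_ratio_def using assms by (intro prod_zero) auto
  moreover have "- of_nat l \<noteq> (of_nat i :: 'a)" if "i \<in> {1..r}" for i
    using that
    by (metis add_eq_0_iff_both_eq_0 atLeastAtMost_iff not_one_le_zero of_nat_add of_nat_eq_0_iff
        neg_eq_iff_add_eq_0)
  ultimately have "0 = 1 - (- 1) ^ r * ?S"
    using reflection_ratio_partial_fraction[of r "- of_nat l :: 'a"] by simp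
  then have "(- 1) ^ r * ((- 1) ^ r * ?S) = (- 1) ^ r"
    by simp
  then show ?thesis
    by (simp flip: power_mult_distrib mult.assoc)
qed

lemma harmonic_add_diff:
  "harmonic (n + k) - harmonic k = (\<Sum>l = 1..n. 1 / (of_nat k + of_nat l) :: 'a :: field)"
  by (induction n) (simp_all add: harmonic_Suc algebra_simps)

lemma sum_sum_divide_add_of_nat:
  "(\<Sum>l = 1..n. \<Sum>i\<in>A. f i / (of_nat (k i) + of_nat l)) =
    (\<Sum>i\<in>A. f i * (harmonic (n + k i) - harmonic (k i)) :: 'a :: field)"
  by (subst sum.swap) (simp add: harmonic_add_diff sum_distrib_left)

lemma sum_legendre_coeff_harmonic:
  "(\<Sum>j = 0..r. of_nat j * legendre_coeff r j * (harmonic (r + j) - harmonic j)) =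
    ((- 1) ^ r * of_nat r :: 'a :: field_char_0)"
proof -
  have "(\<Sum>j = 0..r. of_nat j * legendre_coeff r j * (harmonic (r + j) - harmonic j) :: 'a) =
      (\<Sum>j = 1..r. of_nat j * legendre_coeff r j * (harmonic (r + j) - harmonic j))"
    by (simp add: sum.atLeast_Suc_atMost)
  also have "\<dots> = (\<Sum>l = 1..r. \<Sum>j = 1..r. of_nat j * legendre_coeff r j / (of_nat j + of_nat l))"
    by (rule sum_sum_divide_add_of_nat[symmetric])
  also have "\<dots> = (\<Sum>l = 1..r. (- 1) ^ r)"
    by (intro sum.cong sum_legendre_coeff_divide_add) simp
  finally show ?thesis
    by (simp add: mult.commute)
qed

lemma sum_reflection_ratio:
  assumes "r \<le> n"
  shows "(- 1) ^ r * (\<Sum>j = Suc r..n. reflection_ratio r (of_nat j)) =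
    (- 1) ^ r * of_nat (n - r) +
    (\<Sum>i = 0..r. of_nat i * legendre_coeff r i *
        (harmonic (n - i) - harmonic (r - i)) :: 'a :: field_char_0)"
proof -
  let ?w = "\<lambda>i. of_nat i * legendre_coeff r i :: 'a"
  have "(\<Sum>j = Suc r..n. reflection_ratio r (of_nat j)) =
      (\<Sum>l = 1..n - r. reflection_ratio r (of_nat (r + l) :: 'a))"
    using assms by (intro sum.reindex_bij_witness[of _ "\<lambda>l. r + l" "\<lambda>j. j - r"]) auto
  also have "\<dots> = (\<Sum>l = 1..n - r. 1 + (- 1) ^ r * (\<Sum>i = 1..r. ?w i / (of_nat (r - i) + of_nat l)))"
  proof (intro sum.cong refl)
    fix l assume l: "l \<in> {1..n - r}"
    then have "reflection_ratio r (of_nat (r + l) :: 'a) =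
        1 + (- 1) ^ r * (\<Sum>i = 1..r. ?w i / (of_nat (r + l) - of_nat i))"
      by (intro reflection_ratio_partial_fraction) (auto simp del: of_nat_add)
    also have "(\<Sum>i = 1..r. ?w i / (of_nat (r + l) - of_nat i)) =
        (\<Sum>i = 1..r. ?w i / (of_nat (r - i) + of_nat l))"
      by (intro sum.cong refl) (simp add: of_nat_diff algebra_simps)
    finally show "reflection_ratio r (of_nat (r + l) :: 'a) =
        1 + (- 1) ^ r * (\<Sum>i = 1..r. ?w i / (of_nat (r - i) + of_nat l))" .
  qed
  also have "\<dots> =
      of_nat (n - r) + (- 1) ^ r * (\<Sum>l = 1..n - r. \<Sum>i = 1..r. ?w i / (of_nat (r - i) + of_nat l))"
    by (simp add: sum.distrib sum_distrib_left del: of_nat_diff)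
  also have "(\<Sum>l = 1..n - r. \<Sum>i = 1..r. ?w i / (of_nat (r - i) + of_nat l)) =
      (\<Sum>i = 1..r. ?w i * (harmonic (n - r + (r - i)) - harmonic (r - i)))"
    by (rule sum_sum_divide_add_of_nat)
  also have "(\<Sum>i = 1..r. ?w i * (harmonic (n - r + (r - i)) - harmonic (r - i))) =
      (\<Sum>i = 0..r. ?w i * (harmonic (n - i) - harmonic (r - i)))"
    using assms by (simp add: sum.atLeast_Suc_atMost)
  finally show ?thesis
    by (simp add: distrib_left flip: power_mult_distrib mult.assoc)
qed

lemma Zp_legendre_log_deriv:
  "j \<le> r \<Longrightarrow> 2 * r < CARD('p) \<Longrightarrow> legendre_log_deriv r j \<in> (\<int>\<^sub>p :: 'p :: prime_card padic set)"
  unfolding legendre_log_deriv_def mult_2 by (intro Zp_diff Zp_add Zp_harmonic) auto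

lemma Zp_legendre_coeff [simp]: "legendre_coeff r j \<in> \<int>\<^sub>p"
  unfolding legendre_coeff_def by (intro Zp_mult Zp_power Zp_uminus Zp_1 Zp_of_nat)

lemma fact_cong_0:
  assumes "CARD('p) \<le> n"
  shows "[fact n \<equiv> (0 :: 'p :: prime_card padic)] (mod CARD('p))"
proof -
  have "CARD('p) dvd fact n"
    using assms CARD_prime_card_gt_1[where ?'p = 'p] by (intro dvd_fact) auto
  then show ?thesis
    using padic_cong_of_nat_0_iff[of "fact n", where ?'p = 'p] by simp
qed

lemma reflection_ratio_cong_0:
  assumes "2 * r < CARD('p)" "CARD('p) - r \<le> j" "j < CARD('p)"
  shows "[reflection_ratio r (of_nat j) \<equiv> (0 :: 'p :: prime_card padic)] (mod CARD('p))"
proof -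
  have "reflection_ratio r (of_nat j) =
      fact (j + r) * (fact (j - 1 - r) / (fact j * fact (j - 1)) :: 'p padic)"
    using assms by (subst reflection_ratio_of_nat) auto
  also have "[fact (j + r) * (fact (j - 1 - r) / (fact j * fact (j - 1))) \<equiv>
      0 * (fact (j - 1 - r) / (fact j * fact (j - 1)) :: 'p padic)] (mod CARD('p))"
    using assms by (intro padic_cong_mult fact_cong_0 padic_cong_refl Zp_divide padic_units_mult) auto
  finally show ?thesis
    by simp
qed

lemma sum_legendre_coeff_slope_cong:
  assumes odd: "odd CARD('p :: prime_card)" and r: "2 * r < CARD('p)"
  shows "[(\<Sum>j = 0..r. legendre_coeff r j * (1 + of_nat j * legendre_log_deriv r j)) \<equiv>
    (- 1) ^ r * (1 + of_nat r) +
    (\<Sum>j = 0..r. of_nat j * legendre_coeff r j *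
        (harmonic (r - j) - harmonic (CARD('p) - 1 - j)) :: 'p padic)]
    (mod CARD('p))"
proof -
  let ?w = "legendre_coeff r :: nat \<Rightarrow> 'p padic" and ?H = "harmonic :: nat \<Rightarrow> 'p padic"
  have "(\<Sum>j = 0..r. ?w j * (1 + of_nat j * legendre_log_deriv r j)) =
      (\<Sum>j = 0..r. ?w j) + (\<Sum>j = 0..r. of_nat j * ?w j * (?H (r + j) - ?H j)) +
      (\<Sum>j = 0..r. of_nat j * ?w j * (?H (r - j) - ?H j))"
    unfolding sum.distrib[symmetric]
    by (intro sum.cong refl) (simp add: legendre_log_deriv_def algebra_simps)
  also have "\<dots> = (- 1) ^ r * (1 + of_nat r) + (\<Sum>j = 0..r. of_nat j * ?w j * (?H (r - j) - ?H j))"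
    by (simp only: sum_legendre_coeff sum_legendre_coeff_harmonic distrib_left mult_1_right)
  also have "[(- 1) ^ r * (1 + of_nat r) + (\<Sum>j = 0..r. of_nat j * ?w j * (?H (r - j) - ?H j)) \<equiv>
      (- 1) ^ r * (1 + of_nat r) + (\<Sum>j = 0..r. of_nat j * ?w j * (?H (r - j) - ?H (CARD('p) - 1 - j)))]
          (mod CARD('p))"
    using r by (intro padic_cong_add padic_cong_sum padic_cong_mult padic_cong_diff padic_cong_refl
        padic_cong_sym[OF harmonic_reflect[OF odd]]) auto
  finally show ?thesis .
qed

lemma sum_reflection_ratio_cong:
  assumes r: "2 * r < CARD('p :: prime_card)"
  shows "[(- 1) ^ r * (\<Sum>j = Suc r..CARD('p) - 1 - r. reflection_ratio r (of_nat j)) \<equiv>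
    (- 1) ^ r * (padic_p - 1 - of_nat r) +
    (\<Sum>j = 0..r. of_nat j * legendre_coeff r j *
        (harmonic (CARD('p) - 1 - j) - harmonic (r - j)) :: 'p padic)]
    (mod CARD('p))"
proof -
  let ?p = "CARD('p)"
  let ?R = "\<lambda>j. reflection_ratio r (of_nat j) :: 'p padic"
  let ?B = "\<Sum>j = Suc r..?p - 1 - r. ?R j"
  have tail: "[(\<Sum>j = ?p - r..?p - 1. ?R j) \<equiv> (\<Sum>j = ?p - r..?p - 1. 0)] (mod ?p)"
    using r by (intro padic_cong_sum reflection_ratio_cong_0) auto
  have "?R j \<in> \<int>\<^sub>p" if "j \<in> {Suc r..?p - 1 - r}" for j
    using that by (subst reflection_ratio_of_nat) (auto intro!: Zp_divide padic_units_mult)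
  then have "?B \<in> \<int>\<^sub>p"
    by (rule Zp_sum)
  moreover have "{Suc r..?p - 1} = {Suc r..?p - 1 - r} \<union> {?p - r..?p - 1}"
    using r by auto
  then have "(\<Sum>j = Suc r..?p - 1. ?R j) = ?B + (\<Sum>j = ?p - r..?p - 1. ?R j)"
    using r by (subst sum.union_disjoint[symmetric]) auto
  ultimately have "[?B \<equiv> (\<Sum>j = Suc r..?p - 1. ?R j)] (mod ?p)"
    using padic_cong_add[OF padic_cong_refl padic_cong_sym[OF tail], of ?B] by simp
  then have "[(- 1) ^ r * ?B \<equiv> (- 1) ^ r * (\<Sum>j = Suc r..?p - 1. ?R j)] (mod ?p)"
    by (intro padic_cong_mult padic_cong_refl) auto
  also have "(- 1) ^ r * (\<Sum>j = Suc r..?p - 1. ?R j) = (- 1) ^ r * (padic_p - 1 - of_nat r) +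
      (\<Sum>j = 0..r. of_nat j * legendre_coeff r j * (harmonic (?p - 1 - j) - harmonic (r - j)))"
    using r by (subst sum_reflection_ratio) (auto simp: of_nat_diff)
  finally show ?thesis .
qed

lemma harmonic_sum_cong_0:
  assumes odd: "odd CARD('p :: prime_card)" and r: "2 * r < CARD('p)"
  shows "[(\<Sum>j = 0..r. legendre_coeff r j * (1 + of_nat j * legendre_log_deriv r j)) +
    (- 1) ^ r * (\<Sum>j = Suc r..CARD('p) - 1 - r. reflection_ratio r (of_nat j)) \<equiv> (0 :: 'p padic)]
        (mod CARD('p))"
    (is "[?S \<equiv> 0] (mod _)")
proof -
  let ?v = "\<lambda>j. of_nat j * legendre_coeff r j :: 'p padic" and ?H = "harmonic :: nat \<Rightarrow> 'p padic"
  have "[?S \<equiv>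
      (- 1) ^ r * (1 + of_nat r) + (\<Sum>j = 0..r. ?v j * (?H (r - j) - ?H (CARD('p) - 1 - j))) +
      ((- 1) ^ r * (padic_p - 1 - of_nat r) + (\<Sum>j = 0..r. ?v j * (?H (CARD('p) - 1 - j) - ?H (r - j))))]
          (mod CARD('p))"
    by (intro padic_cong_add sum_legendre_coeff_slope_cong sum_reflection_ratio_cong assms)
  also have "(- 1) ^ r * (1 + of_nat r) + (\<Sum>j = 0..r. ?v j * (?H (r - j) - ?H (CARD('p) - 1 - j))) +
      ((- 1) ^ r * (padic_p - 1 - of_nat r) + (\<Sum>j = 0..r. ?v j * (?H (CARD('p) - 1 - j) - ?H (r - j)))) =
      padic_p * (- 1) ^ r"
    by (simp add: algebra_simps sum_subtractf)
  also have "[padic_p * (- 1) ^ r \<equiv> (0 :: 'p padic)] (mod CARD('p))"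
    by (rule padic_congI[of _ _ _ "(- 1) ^ r"]) auto
  finally show ?thesis .
qed

section \<open>The terms of both sides as values of one quotient of gamma functions\<close>

definition pochhammer_p_part :: "'p :: prime_card padic \<Rightarrow> nat \<Rightarrow> 'p padic" where
  "pochhammer_p_part x n = (\<Prod>i<n. if [x + of_nat i \<equiv> 0] (mod CARD('p)) then x + of_nat i else 1)"

lemma pochhammer_eq_Gamma_p:
  fixes x :: "'p :: prime_card padic"
  assumes "odd CARD('p)" "x \<in> \<int>\<^sub>p"
  shows "pochhammer x n = (- 1) ^ n * \<Gamma>\<^sub>p (x + of_nat n) / \<Gamma>\<^sub>p x * pochhammer_p_part x n"
proof (induction n)
  case 0
  then show ?case
    using padic_unitsD(2)[OF Gamma_p_unit[OF assms]] by (simp add: pochhammer_p_part_def)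
next
  case (Suc n)
  have "\<Gamma>\<^sub>p (x + of_nat (Suc n)) =
      - (if [x + of_nat n \<equiv> 0] (mod CARD('p)) then 1 else x + of_nat n) * \<Gamma>\<^sub>p (x + of_nat n)"
    using Gamma_p_plus_1[OF assms(1), of "x + of_nat n"] assms(2) by (simp add: ac_simps)
  then show ?case
    by (simp add: pochhammer_Suc Suc pochhammer_p_part_def)
qed

lemma pochhammer_p_part_near_neg_nat:
  fixes y :: "'p :: prime_card padic"
  assumes "y \<in> \<int>\<^sub>p" "s < CARD('p)" "n \<le> CARD('p)"
  shows "pochhammer_p_part (- of_nat s + padic_p * y) n = (if s < n then padic_p * y else 1)"
proof -
  have "[- of_nat s + padic_p * y + of_nat i \<equiv> 0] (mod CARD('p)) \<longleftrightarrow> i = s" if "i < n" for i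
  proof -
    have "[- of_nat s + padic_p * y + of_nat i \<equiv> of_nat i - of_nat s] (mod CARD('p))"
      using assms(1) by (intro padic_congI[of _ _ _ y]) auto
    then have "[- of_nat s + padic_p * y + of_nat i \<equiv> 0] (mod CARD('p)) \<longleftrightarrow>
        [of_nat i - of_nat s \<equiv> (0 :: 'p padic)] (mod CARD('p))"
      by (meson padic_cong_sym padic_cong_trans)
    also have "\<dots> \<longleftrightarrow> [of_nat i \<equiv> (of_nat s :: 'p padic)] (mod CARD('p))"
      by (auto simp: padic_cong_def)
    also have "\<dots> \<longleftrightarrow> i = s"
      using that assms(2,3) by (simp add: padic_cong_of_nat_iff cong_def)
    finally show ?thesis .
  qed
  then have "pochhammer_p_part (- of_nat s + padic_p * y) n = (\<Prod>i<n. if i = s then padic_p * y else 1)"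
    unfolding pochhammer_p_part_def by (intro prod.cong) auto
  then show ?thesis
    by simp
qed

lemma fact_square_eq_Gamma_p_square:
  assumes "odd CARD('p :: prime_card)" "n < CARD('p)"
  shows "(fact n)\<^sup>2 = (\<Gamma>\<^sub>p (1 + of_nat n) :: 'p padic)\<^sup>2"
proof -
  have "pochhammer_p_part (1 :: 'p padic) n = 1"
    using pochhammer_p_part_near_neg_nat[of "1 :: 'p padic" "CARD('p) - 1" n] assms(2)
    by (simp add: of_nat_diff)
  moreover have "\<Gamma>\<^sub>p (1 :: 'p padic) = - 1"
    using Gamma_p_plus_1[OF assms(1), of 0] Gamma_p_0[OF assms(1)] by simp
  ultimately have "(fact n :: 'p padic) = - ((- 1) ^ n * \<Gamma>\<^sub>p (1 + of_nat n))"
    using pochhammer_eq_Gamma_p[OF assms(1), of 1 n] by (simp add: pochhammer_fact)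
  then show "(fact n)\<^sup>2 = (\<Gamma>\<^sub>p (1 + of_nat n :: 'p padic))\<^sup>2"
    by (simp add: power_mult_distrib flip: power_mult)
qed

definition hyp_term :: "'a :: field_char_0 \<Rightarrow> nat \<Rightarrow> 'a" where
  "hyp_term b j = pochhammer b j * pochhammer (1 - b) j / (fact j)\<^sup>2"

lemma hyp_term_reflect: "hyp_term (1 - b) j = hyp_term b j"
  by (simp add: hyp_term_def mult.commute)

lemma Zp_hyp_term: "b \<in> \<int>\<^sub>p \<Longrightarrow> j < CARD('p) \<Longrightarrow> hyp_term b j \<in> (\<int>\<^sub>p :: 'p :: prime_card padic set)"
  by (simp add: hyp_term_def)

definition gamma_quotient :: "'p :: prime_card padic \<Rightarrow> 'p padic \<Rightarrow> 'p padic" where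
  "gamma_quotient b y = \<Gamma>\<^sub>p (b + y) * \<Gamma>\<^sub>p (1 - b + y) / (\<Gamma>\<^sub>p b * \<Gamma>\<^sub>p (1 - b) * (\<Gamma>\<^sub>p (1 + y))\<^sup>2)"

lemma gamma_quotient_reflect: "gamma_quotient (1 - b) y = gamma_quotient b y"
  by (simp add: gamma_quotient_def mult.commute)

lemma gamma_quotient_unit:
  fixes b y :: "'p :: prime_card padic"
  assumes "odd CARD('p)" "b \<in> \<int>\<^sub>p" "y \<in> \<int>\<^sub>p"
  shows "gamma_quotient b y \<in> padic_units"
  unfolding gamma_quotient_def using assms
  by (intro padic_units_divide padic_units_mult padic_units_power Gamma_p_unit) auto

lemma hyp_term_eq_gamma_quotient:
  fixes b :: "'p :: prime_card padic"
  assumes "odd CARD('p)" "b \<in> \<int>\<^sub>p" "j < CARD('p)"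
  shows "hyp_term b j =
    gamma_quotient b (of_nat j) * (pochhammer_p_part b j * pochhammer_p_part (1 - b) j)"
proof -
  have "1 - b \<in> \<int>\<^sub>p"
    using assms(2) by simp
  then show ?thesis
    unfolding hyp_term_def gamma_quotient_def fact_square_eq_Gamma_p_square[OF assms(1,3)]
      pochhammer_eq_Gamma_p[OF assms(1,2)] pochhammer_eq_Gamma_p[OF assms(1) \<open>1 - b \<in> \<int>\<^sub>p\<close>]
    by (simp add: ac_simps flip: power_mult_distrib)
qed

locale padic_near_neg_nat =
  fixes r :: nat and a b :: "'p :: prime_card padic"
  assumes odd_p: "odd CARD('p)" and two_r_less: "2 * r < CARD('p)"
    and a_in_Zp: "a \<in> \<int>\<^sub>p" and b_eq: "b = - of_nat r + padic_p * a"
begin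

lemma b_in_Zp: "b \<in> \<int>\<^sub>p"
  using a_in_Zp by (simp add: b_eq)

lemma hyp_term_eq:
  assumes "j < CARD('p)"
  shows "hyp_term b j = gamma_quotient b (of_nat j) *
    ((if r < j then padic_p * a else 1) * (if CARD('p) - 1 - r < j then padic_p * (1 - a) else 1))"
proof -
  have "1 - b = - of_nat (CARD('p) - 1 - r) + padic_p * (1 - a)"
    using two_r_less by (simp add: b_eq of_nat_diff algebra_simps)
  then have "pochhammer_p_part (1 - b) j = (if CARD('p) - 1 - r < j then padic_p * (1 - a) else 1)"
    using assms a_in_Zp by (simp only:) (subst pochhammer_p_part_near_neg_nat, auto)
  moreover have "pochhammer_p_part b j = (if r < j then padic_p * a else 1)"
    unfolding b_eq using assms two_r_less a_in_Zp by (subst pochhammer_p_part_near_neg_nat) auto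
  ultimately show ?thesis
    using hyp_term_eq_gamma_quotient[OF odd_p b_in_Zp assms] by simp
qed

lemma hyp_term_cong_0:
  assumes "CARD('p) - r \<le> j" "j < CARD('p)"
  shows "[hyp_term b j \<equiv> 0] (mod CARD('p)\<^sup>2)"
proof (rule padic_congI)
  have later: "r < j" "CARD('p) - 1 - r < j"
    using assms two_r_less by linarith+
  show "hyp_term b j = 0 + of_nat (CARD('p)\<^sup>2) * (gamma_quotient b (of_nat j) * (a * (1 - a)))"
    unfolding hyp_term_eq[OF assms(2)] using later by (simp add: power2_eq_square)
  show "gamma_quotient b (of_nat j) * (a * (1 - a)) \<in> \<int>\<^sub>p"
    using a_in_Zp padic_unitsD(1)[OF gamma_quotient_unit[OF odd_p b_in_Zp]] by simp
qed simp

lemma gamma_quotient_jet: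
  assumes "r + j < CARD('p)" "\<delta> \<in> \<int>\<^sub>p"
    and jet: "padic_jet (\<Gamma>\<^sub>p (b + (of_nat j + padic_p * \<delta>))) u s"
  shows "padic_jet (gamma_quotient b (of_nat j + padic_p * \<delta>))
      ((- 1) ^ j * (u * fact (r + j) / (fact j)\<^sup>2))
    (s + (\<delta> - a) * (Gamma_p_slope + harmonic (r + j)) - 2 * \<delta> * (Gamma_p_slope + harmonic j))"
proof -
  let ?g = "Gamma_p_slope :: 'p padic" and ?H = "harmonic :: nat \<Rightarrow> 'p padic"
  let ?y = "of_nat j + padic_p * \<delta>"
  have "1 - b + ?y = of_nat (Suc (r + j)) + padic_p * (\<delta> - a)"
    by (simp add: b_eq algebra_simps)
  then have jet_1_minus_b_plus:
      "padic_jet (\<Gamma>\<^sub>p (1 - b + ?y)) ((- 1) ^ Suc (r + j) * fact (r + j)) ((\<delta> - a) * (?g + ?H (r + j)))"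
    using assms(1,2) a_in_Zp by (simp only:) (intro Gamma_p_jet_pos odd_p; simp)
  have jet_b: "padic_jet (\<Gamma>\<^sub>p b) (1 / fact r) (a * (?g + ?H r))"
    unfolding b_eq using two_r_less a_in_Zp by (intro Gamma_p_jet_neg odd_p) auto
  have "1 - b = of_nat (Suc r) + padic_p * (- a)"
    by (simp add: b_eq)
  then have jet_1_minus_b: "padic_jet (\<Gamma>\<^sub>p (1 - b)) ((- 1) ^ Suc r * fact r) (- a * (?g + ?H r))"
    using two_r_less a_in_Zp by (simp only:) (intro Gamma_p_jet_pos odd_p; simp)
  have "1 + ?y = of_nat (Suc j) + padic_p * \<delta>"
    by simp
  then have jet_1_plus: "padic_jet (\<Gamma>\<^sub>p (1 + ?y)) ((- 1) ^ Suc j * fact j) (\<delta> * (?g + ?H j))"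
    using assms(1,2) by (simp only:) (intro Gamma_p_jet_pos odd_p; simp)
  have "padic_jet (gamma_quotient b ?y)
      (u * ((- 1) ^ Suc (r + j) * fact (r + j)) /
        (1 / fact r * ((- 1) ^ Suc r * fact r) * ((- 1) ^ Suc j * fact j * ((- 1) ^ Suc j * fact j))))
      (s + (\<delta> - a) * (?g + ?H (r + j)) -
        (a * (?g + ?H r) + - a * (?g + ?H r) + (\<delta> * (?g + ?H j) + \<delta> * (?g + ?H j))))"
    unfolding gamma_quotient_def power2_eq_square
    by (intro padic_jet_divide padic_jet_mult jet jet_1_minus_b_plus jet_b jet_1_minus_b jet_1_plus)
  moreover have "u * ((- 1) ^ Suc (r + j) * fact (r + j)) /
      (1 / fact r * ((- 1) ^ Suc r * fact r) * ((- 1) ^ Suc j * fact j * ((- 1) ^ Suc j * fact j))) =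
      (- 1) ^ j * (u * fact (r + j) / (fact j)\<^sup>2)"
    by (cases "even r"; cases "even j") (simp_all add: power2_eq_square)
  moreover have "s + (\<delta> - a) * (?g + ?H (r + j)) -
      (a * (?g + ?H r) + - a * (?g + ?H r) + (\<delta> * (?g + ?H j) + \<delta> * (?g + ?H j))) =
      s + (\<delta> - a) * (?g + ?H (r + j)) - 2 * \<delta> * (?g + ?H j)"
    by (simp add: algebra_simps)
  ultimately show ?thesis
    by (simp only:)
qed

lemma gamma_quotient_jet_head:
  assumes "j \<le> r" "\<delta> \<in> \<int>\<^sub>p"
  shows "padic_jet (gamma_quotient b (of_nat j + padic_p * \<delta>)) (legendre_coeff r j)
    (a * (harmonic (r - j) - harmonic (r + j)) + \<delta> * legendre_log_deriv r j)"
proof -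
  let ?g = "Gamma_p_slope :: 'p padic"
  have "b + (of_nat j + padic_p * \<delta>) = - of_nat (r - j) + padic_p * (a + \<delta>)"
    using assms(1) by (simp add: b_eq of_nat_diff algebra_simps)
  then have "padic_jet (\<Gamma>\<^sub>p (b + (of_nat j + padic_p * \<delta>))) (1 / fact (r - j))
      ((a + \<delta>) * (?g + harmonic (r - j)))"
    using two_r_less assms(2) a_in_Zp by (simp only:) (intro Gamma_p_jet_neg odd_p; simp)
  then have "padic_jet (gamma_quotient b (of_nat j + padic_p * \<delta>))
      ((- 1) ^ j * (1 / fact (r - j) * fact (r + j) / (fact j)\<^sup>2))
      ((a + \<delta>) * (?g + harmonic (r - j)) + (\<delta> - a) * (?g + harmonic (r + j)) -
          2 * \<delta> * (?g + harmonic j))"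
    using assms two_r_less by (intro gamma_quotient_jet) auto
  moreover have "(a + \<delta>) * (?g + harmonic (r - j)) + (\<delta> - a) * (?g + harmonic (r + j)) -
      2 * \<delta> * (?g + harmonic j) =
      a * (harmonic (r - j) - harmonic (r + j)) + \<delta> * legendre_log_deriv r j"
    by (simp add: legendre_log_deriv_def algebra_simps)
  ultimately show ?thesis
    using assms(1) by (simp add: legendre_coeff_fact)
qed

lemma gamma_quotient_cong_middle:
  assumes "r < j" "j < CARD('p) - r" "\<delta> \<in> \<int>\<^sub>p"
  shows "[gamma_quotient b (of_nat j + padic_p * \<delta>) \<equiv>
    (- 1) ^ r * reflection_ratio r (of_nat j) / of_nat j] (mod CARD('p))"
proof -
  obtain k where k: "j = r + Suc k"
    using assms(1) less_imp_Suc_add by auto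
  have "b + (of_nat j + padic_p * \<delta>) = of_nat (Suc k) + padic_p * (a + \<delta>)"
    by (simp add: b_eq k algebra_simps)
  then have "padic_jet (\<Gamma>\<^sub>p (b + (of_nat j + padic_p * \<delta>))) ((- 1) ^ Suc k * fact k)
      ((a + \<delta>) * (Gamma_p_slope + harmonic k))"
    using assms(2,3) k a_in_Zp by (simp only:) (intro Gamma_p_jet_pos odd_p; simp)
  then have "[gamma_quotient b (of_nat j + padic_p * \<delta>) \<equiv>
      (- 1) ^ j * ((- 1) ^ Suc k * fact k * fact (r + j) / (fact j)\<^sup>2)] (mod CARD('p))"
    using assms two_r_less by (intro padic_jet_coeff_cong[OF gamma_quotient_jet]) auto
  moreover have "(- 1) ^ j * ((- 1) ^ Suc k * fact k * fact (r + j) / (fact j)\<^sup>2) =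
      (- 1) ^ r * (fact (r + j) * fact k / (fact j)\<^sup>2 :: 'p padic)"
    by (cases "even r"; cases "even k") (simp_all add: k)
  moreover have "reflection_ratio r (of_nat j) / of_nat j =
      (fact (r + j) * fact k / (fact j)\<^sup>2 :: 'p padic)"
    using reflection_ratio_of_nat[OF assms(1), where ?'a = "'p padic"]
    by (simp add: k power2_eq_square ac_simps del: of_nat_Suc of_nat_add)
  ultimately show ?thesis
    by (simp flip: times_divide_eq_right)
qed

lemma gamma_quotient_perturbation_head:
  assumes "j \<le> r" "y \<in> \<int>\<^sub>p" and y: "y = of_nat j + padic_p * y"
  shows "[gamma_quotient b y / (1 - padic_p) - hyp_term b j \<equiv>
    padic_p * (legendre_coeff r j * (1 + of_nat j * legendre_log_deriv r j))]
    (mod CARD('p)\<^sup>2)"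
proof -
  let ?s = "a * (harmonic (r - j) - harmonic (r + j)) :: 'p padic"
  let ?h = "legendre_log_deriv r j :: 'p padic"
  have "padic_jet (1 + padic_p * (- 1)) 1 (- 1 / 1 :: 'p padic)"
    by (intro padic_jet_add) auto
  then have "padic_jet (1 - padic_p) 1 (- 1 :: 'p padic)"
    by simp
  moreover have "padic_jet (gamma_quotient b y) (legendre_coeff r j) (?s + y * ?h)"
    using gamma_quotient_jet_head[OF assms(1,2)] by (simp only: y[symmetric])
  ultimately have
      "padic_jet (gamma_quotient b y / (1 - padic_p)) (legendre_coeff r j / 1) (?s + y * ?h - - 1)"
    by (intro padic_jet_divide)
  moreover have "hyp_term b j = gamma_quotient b (of_nat j + padic_p * 0)"
    using assms(1) two_r_less by (subst hyp_term_eq) auto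
  then have "padic_jet (hyp_term b j) (legendre_coeff r j) (?s + 0 * ?h)"
    using gamma_quotient_jet_head[OF assms(1), of 0] by simp
  ultimately have "[gamma_quotient b y / (1 - padic_p) - hyp_term b j \<equiv>
      padic_p * (legendre_coeff r j * (?s + y * ?h - - 1 - (?s + 0 * ?h)))] (mod CARD('p)\<^sup>2)"
    by (intro padic_jet_diff_cong) simp_all
  also have "?s + y * ?h - - 1 - (?s + 0 * ?h) = 1 + y * ?h"
    by simp
  also have "[padic_p * (legendre_coeff r j * (1 + y * ?h)) \<equiv>
      padic_p * (legendre_coeff r j * (1 + of_nat j * ?h))] (mod CARD('p)\<^sup>2)"
  proof (intro padic_cong_scale_p padic_cong_mult padic_cong_add padic_cong_refl)
    show "[y \<equiv> of_nat j] (mod CARD('p))"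
      using assms(2) by (intro padic_congI[OF y]) auto
    show "?h \<in> \<int>\<^sub>p"
      using assms(1) two_r_less by (rule Zp_legendre_log_deriv)
  qed auto
  finally show ?thesis .
qed

lemma gamma_quotient_perturbation_middle:
  assumes "r < j" "j < CARD('p) - r" "y \<in> \<int>\<^sub>p" and y: "y = of_nat j + padic_p * y"
  shows "[padic_p * (a + y) * (gamma_quotient b y / (1 - padic_p)) - hyp_term b j \<equiv>
    padic_p * ((- 1) ^ r * reflection_ratio r (of_nat j))] (mod CARD('p)\<^sup>2)"
proof -
  let ?c = "(- 1) ^ r * reflection_ratio r (of_nat j) / of_nat j :: 'p padic"
  have "[gamma_quotient b y / (1 - padic_p) \<equiv> ?c] (mod CARD('p))"
  proof -
    have "[gamma_quotient b y \<equiv> ?c] (mod CARD('p))"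
      using gamma_quotient_cong_middle[OF assms(1-3)] by (simp only: y[symmetric])
    moreover have "[inverse (1 - padic_p) \<equiv> inverse (1 :: 'p padic)] (mod CARD('p))"
      using padic_units_1_plus[of "- 1 :: 'p padic"]
      by (intro padic_cong_inverse padic_congI[of _ _ _ "- 1"]) auto
    ultimately show ?thesis
      using padic_cong_mult by (fastforce simp: divide_inverse)
  qed
  moreover have "[a + y \<equiv> a + of_nat j] (mod CARD('p))"
    using y assms(3) a_in_Zp by (intro padic_cong_add padic_cong_refl padic_congI) auto
  moreover have "[gamma_quotient b (of_nat j) \<equiv> ?c] (mod CARD('p))"
    using gamma_quotient_cong_middle[OF assms(1,2), of 0] by simp
  ultimately have
      "[padic_p * ((a + y) * (gamma_quotient b y / (1 - padic_p)) - a * gamma_quotient b (of_nat j)) \<equiv>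
      padic_p * ((a + of_nat j) * ?c - a * ?c)] (mod CARD('p)\<^sup>2)"
    using a_in_Zp by (intro padic_cong_scale_p padic_cong_diff padic_cong_mult padic_cong_refl)
  moreover have "hyp_term b j = padic_p * (a * gamma_quotient b (of_nat j))"
    using assms(1,2) by (subst hyp_term_eq) auto
  moreover have "(a + of_nat j) * ?c - a * ?c = (- 1) ^ r * reflection_ratio r (of_nat j)"
    using assms(1) by (simp only: distrib_right add_diff_cancel_left') simp
  ultimately show ?thesis
    by (simp only: right_diff_distrib[of padic_p, symmetric] mult.assoc)
qed

lemma sum_head_middle_tail:
  "(\<Sum>j = 0..CARD('p) - 1. f j) =
    (\<Sum>j = 0..r. f j) + (\<Sum>j = Suc r..CARD('p) - 1 - r. f j) + (\<Sum>j = CARD('p) - r..CARD('p) - 1. f j)"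
proof -
  have "{0..CARD('p) - 1} = {0..r} \<union> {Suc r..CARD('p) - 1 - r} \<union> {CARD('p) - r..CARD('p) - 1}"
    using two_r_less by auto
  then show ?thesis
    using two_r_less by (simp only:) (subst sum.union_disjoint, auto simp: sum.union_disjoint)
qed

lemma sum_cong_0_if_perturbation:
  fixes D :: "nat \<Rightarrow> 'p padic"
  assumes head: "\<And>j. j \<le> r \<Longrightarrow>
      [D j \<equiv> padic_p * (legendre_coeff r j * (1 + of_nat j * legendre_log_deriv r j))] (mod CARD('p)\<^sup>2)"
    and middle: "\<And>j. r < j \<Longrightarrow> j < CARD('p) - r \<Longrightarrow>
      [D j \<equiv> padic_p * ((- 1) ^ r * reflection_ratio r (of_nat j))] (mod CARD('p)\<^sup>2)"
    and tail: "\<And>j. CARD('p) - r \<le> j \<Longrightarrow> j < CARD('p) \<Longrightarrow> [D j \<equiv> 0] (mod CARD('p)\<^sup>2)"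
  shows "[(\<Sum>j = 0..CARD('p) - 1. D j) \<equiv> 0] (mod CARD('p)\<^sup>2)"
proof -
  let ?p = "CARD('p)"
  let ?w = "\<lambda>j. legendre_coeff r j * (1 + of_nat j * legendre_log_deriv r j) :: 'p padic"
  let ?R = "\<lambda>j. reflection_ratio r (of_nat j) :: 'p padic"
  have "[(\<Sum>j = 0..?p - 1. D j) \<equiv> (\<Sum>j = 0..r. padic_p * ?w j) +
      (\<Sum>j = Suc r..?p - 1 - r. padic_p * ((- 1) ^ r * ?R j)) + (\<Sum>j = ?p - r..?p - 1. 0)] (mod ?p\<^sup>2)"
    unfolding sum_head_middle_tail using two_r_less
    by (intro padic_cong_add padic_cong_sum head middle tail) auto
  also have "(\<Sum>j = 0..r. padic_p * ?w j) + (\<Sum>j = Suc r..?p - 1 - r. padic_p * ((- 1) ^ r * ?R j)) +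
      (\<Sum>j = ?p - r..?p - 1. 0) =
      padic_p * ((\<Sum>j = 0..r. ?w j) + (- 1) ^ r * (\<Sum>j = Suc r..?p - 1 - r. ?R j))"
    by (simp only: distrib_left sum_distrib_left sum.neutral_const add_0_right)
  also have "[padic_p * ((\<Sum>j = 0..r. ?w j) + (- 1) ^ r * (\<Sum>j = Suc r..?p - 1 - r. ?R j)) \<equiv>
      padic_p * 0] (mod ?p\<^sup>2)"
    by (intro padic_cong_scale_p harmonic_sum_cong_0 odd_p two_r_less)
  finally show ?thesis
    by simp
qed

lemma sum_cong_sum_hyp_term:
  fixes f y :: "nat \<Rightarrow> 'p padic"
  assumes y: "\<And>j. y j \<in> \<int>\<^sub>p" "\<And>j. y j = of_nat j + padic_p * y j"
    and head: "\<And>j. j \<le> r \<Longrightarrow> f j = gamma_quotient b (y j) / (1 - padic_p)"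
    and middle: "\<And>j. r < j \<Longrightarrow> j < CARD('p) - r \<Longrightarrow>
      [f j \<equiv> padic_p * (a + y j) * (gamma_quotient b (y j) / (1 - padic_p))] (mod CARD('p)\<^sup>2)"
    and tail: "\<And>j. CARD('p) - r \<le> j \<Longrightarrow> j < CARD('p) \<Longrightarrow> [f j \<equiv> 0] (mod CARD('p)\<^sup>2)"
  shows "[(\<Sum>j = 0..CARD('p) - 1. f j) \<equiv> (\<Sum>j = 0..CARD('p) - 1. hyp_term b j)] (mod CARD('p)\<^sup>2)"
proof -
  have "[(\<Sum>j = 0..CARD('p) - 1. f j - hyp_term b j) \<equiv> 0] (mod CARD('p)\<^sup>2)"
  proof (rule sum_cong_0_if_perturbation)
    fix j assume "j \<le> r"
    then show "[f j - hyp_term b j \<equiv>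
        padic_p * (legendre_coeff r j * (1 + of_nat j * legendre_log_deriv r j))] (mod CARD('p)\<^sup>2)"
      using y by (simp only: head) (rule gamma_quotient_perturbation_head)
  next
    fix j assume j: "r < j" "j < CARD('p) - r"
    then have "hyp_term b j \<in> \<int>\<^sub>p"
      by (intro Zp_hyp_term b_in_Zp) simp
    then have "[f j - hyp_term b j \<equiv>
        padic_p * (a + y j) * (gamma_quotient b (y j) / (1 - padic_p)) - hyp_term b j] (mod CARD('p)\<^sup>2)"
      by (intro padic_cong_diff padic_cong_refl middle j)
    also have "[padic_p * (a + y j) * (gamma_quotient b (y j) / (1 - padic_p)) - hyp_term b j \<equiv>
        padic_p * ((- 1) ^ r * reflection_ratio r (of_nat j))] (mod CARD('p)\<^sup>2)"
      using j y by (rule gamma_quotient_perturbation_middle)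
    finally show "[f j - hyp_term b j \<equiv>
        padic_p * ((- 1) ^ r * reflection_ratio r (of_nat j))] (mod CARD('p)\<^sup>2)" .
  next
    fix j assume "CARD('p) - r \<le> j" "j < CARD('p)"
    then show "[f j - hyp_term b j \<equiv> 0] (mod CARD('p)\<^sup>2)"
      using padic_cong_diff[OF tail hyp_term_cong_0] by fastforce
  qed
  moreover have "(\<Sum>j = 0..CARD('p) - 1. hyp_term b j) \<in> \<int>\<^sub>p"
    using two_r_less by (intro Zp_sum Zp_hyp_term b_in_Zp) auto
  ultimately show ?thesis
    using padic_cong_add[OF _ padic_cong_refl] by (fastforce simp: sum_subtractf)
qed

end

section \<open>The function G\<close>

definition G_shift :: "nat \<Rightarrow> nat \<Rightarrow> rat" where
  "G_shift p j = - (of_nat j / (of_nat p - 1))"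

definition G_factor :: "rat \<Rightarrow> rat \<Rightarrow> 'p :: prime_card padic" where
  "G_factor q s = padic_gamma_rat (frac (q + s)) / padic_gamma_rat q * (- padic_p) powi (- \<lfloor>q + s\<rfloor>)"

definition G_term :: "rat \<Rightarrow> nat \<Rightarrow> 'p :: prime_card padic" where
  "(G_term q j :: 'p padic) = - 1 / (padic_p - 1) * (padic_gamma_rat (- G_shift CARD('p) j))\<^sup>2 *
     (G_factor q (G_shift CARD('p) j) * G_factor (1 - q) (G_shift CARD('p) j))"

lemma padic_G_eq_sum_G_term:
  "(padic_G [q, 1 - q] :: 'p :: prime_card padic) = (\<Sum>j = 0..CARD('p) - 2. G_term q j)"
proof -
  have "((- 1) ^ j * x) ^ length [q, 1 - q] = x\<^sup>2" for j and x :: "'p padic"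
    by (simp add: power_mult_distrib power2_eq_square flip: power_add mult_2)
  moreover have "prod_list (map f [q, 1 - q]) = f q * f (1 - q)" for f :: "rat \<Rightarrow> 'p padic"
    by simp
  ultimately show ?thesis
    unfolding padic_G_def Let_def sum_distrib_left
    by (intro sum.cong refl)
      (simp only: G_term_def G_factor_def G_shift_def mult.assoc minus_minus add_uminus_conv_diff)
qed

lemma of_rat_pochhammer: "of_rat (pochhammer q k) = pochhammer (of_rat q) k"
  by (induction k) (simp_all add: pochhammer_Suc of_rat_mult of_rat_add)

lemma of_rat_fact: "of_rat (fact k) = fact k"
  by (metis of_nat_fact of_rat_of_nat_eq)

lemma of_rat_truncated_hypergeometric:
  "of_rat (truncated_hypergeometric [q, 1 - q] [1] 1 n) = (\<Sum>k = 0..n. hyp_term (of_rat q) k)"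
  unfolding truncated_hypergeometric_def of_rat_sum
  by (intro sum.cong refl)
    (simp add: hyp_term_def of_rat_mult of_rat_divide of_rat_pochhammer of_rat_diff of_rat_fact
      power2_eq_square flip: pochhammer_fact)

lemma of_rat_G_shift:
  shows of_rat_G_shift_in_Zp: "of_rat (G_shift CARD('p) j) \<in> (\<int>\<^sub>p :: 'p :: prime_card padic set)"
    and of_rat_G_shift_eq:
      "of_rat (G_shift CARD('p) j) = of_nat j + (padic_p :: 'p padic) * of_rat (G_shift CARD('p) j)"
proof -
  have unit: "1 - padic_p \<in> (padic_units :: 'p padic set)"
    using padic_units_1_plus[of "- 1 :: 'p padic"] by simp
  have "of_rat (G_shift CARD('p) j) = - (of_nat j / (padic_p - 1) :: 'p padic)"
    by (simp add: G_shift_def of_rat_minus of_rat_divide of_rat_diff)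
  also have "\<dots> = of_nat j / (1 - padic_p)"
    by (metis minus_diff_eq minus_divide_right)
  finally have eq: "of_rat (G_shift CARD('p) j) = (of_nat j / (1 - padic_p) :: 'p padic)" .
  show "of_rat (G_shift CARD('p) j) \<in> (\<int>\<^sub>p :: 'p padic set)"
    unfolding eq using unit by simp
  show "of_rat (G_shift CARD('p) j) = of_nat j + (padic_p :: 'p padic) * of_rat (G_shift CARD('p) j)"
    unfolding eq using padic_unitsD(2)[OF unit] by (simp add: field_simps)
qed

definition floor_factor :: "rat \<Rightarrow> 'p :: prime_card padic" where
  "floor_factor t = (if 0 \<le> t then 1
     else padic_p * (if [of_rat t \<equiv> (0 :: 'p padic)] (mod CARD('p)) then 1 else of_rat t))"

lemma Zp_floor_factor:
  "of_rat t \<in> (\<int>\<^sub>p :: 'p :: prime_card padic set) \<Longrightarrow>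
    floor_factor t \<in> (\<int>\<^sub>p :: 'p padic set)"
  by (simp add: floor_factor_def)

lemma floor_factor_neg_cong_0:
  assumes "t < 0" "of_rat t \<in> (\<int>\<^sub>p :: 'p :: prime_card padic set)"
  shows "[floor_factor t \<equiv> (0 :: 'p padic)] (mod CARD('p))"
  using assms
  by (intro padic_congI[of _ _ _ "if [of_rat t \<equiv> (0 :: 'p padic)] (mod CARD('p)) then 1 else of_rat t"])
    (auto simp: floor_factor_def)

lemma G_factor_eq:
  fixes q s :: rat
  assumes "odd CARD('p :: prime_card)" "- 1 \<le> q + s" "q + s < 1" "of_rat (q + s) \<in> (\<int>\<^sub>p :: 'p padic set)"
  shows "G_factor q s = (\<Gamma>\<^sub>p (of_rat (q + s)) / \<Gamma>\<^sub>p (of_rat q) * floor_factor (q + s) :: 'p padic)"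
proof (cases "0 \<le> q + s")
  case True
  then have "\<lfloor>q + s\<rfloor> = 0"
    using assms(3) by (simp add: floor_eq_iff)
  then show ?thesis
    using True by (simp add: G_factor_def frac_def floor_factor_def padic_gamma_rat_eq_Gamma_p)
next
  case False
  then have "\<lfloor>q + s\<rfloor> = - 1"
    using assms(2) by (simp add: floor_eq_iff)
  then have "G_factor q s = (\<Gamma>\<^sub>p (of_rat (q + s) + 1) / \<Gamma>\<^sub>p (of_rat q) * - padic_p :: 'p padic)"
    by (simp add: G_factor_def frac_def padic_gamma_rat_eq_Gamma_p of_rat_add)
  then show ?thesis
    using False by (simp add: Gamma_p_plus_1[OF assms(1,4)] floor_factor_def)
qed

lemma G_shift_bounds:
  assumes "j < CARD('p :: prime_card)"
  shows "- 1 \<le> G_shift CARD('p) j" "G_shift CARD('p) j \<le> 0"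
proof -
  have "of_nat j \<le> (of_nat (CARD('p) - 1) :: rat)" "0 < (of_nat (CARD('p) - 1) :: rat)"
    using assms CARD_prime_card_gt_1[where ?'p = 'p] by (simp_all only: of_nat_le_iff of_nat_0_less_iff)
  then show "- 1 \<le> G_shift CARD('p) j" "G_shift CARD('p) j \<le> 0"
    using assms by (simp_all add: G_shift_def of_nat_diff)
qed

lemma G_term_eq:
  fixes q :: rat
  assumes odd: "odd CARD('p :: prime_card)" and q: "0 < q" "q < 1" "of_rat q \<in> (\<int>\<^sub>p :: 'p padic set)"
    and j: "j < CARD('p)"
  shows "G_term q j = gamma_quotient (of_rat q) (of_rat (G_shift CARD('p) j)) / (1 - padic_p) *
    (floor_factor (q + G_shift CARD('p) j) * floor_factor (1 - q + G_shift CARD('p) j) :: 'p padic)"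
proof -
  let ?s = "G_shift CARD('p) j"
  define y where "y = (of_rat ?s :: 'p padic)"
  have y: "y \<in> \<int>\<^sub>p"
    unfolding y_def by (rule of_rat_G_shift_in_Zp)
  have of_rat_eqs: "of_rat (q + ?s) = of_rat q + y" "of_rat (1 - q + ?s) = 1 - of_rat q + y"
      "of_rat (1 - q) = (1 - of_rat q :: 'p padic)" "of_rat (- ?s) = - y"
    by (simp_all add: y_def of_rat_add of_rat_diff of_rat_minus)
  have "G_factor q ?s = \<Gamma>\<^sub>p (of_rat q + y) / \<Gamma>\<^sub>p (of_rat q) * floor_factor (q + ?s)"
    using G_shift_bounds[OF j] q y by (subst G_factor_eq[OF odd]) (auto simp: of_rat_eqs)
  moreover have
      "G_factor (1 - q) ?s = \<Gamma>\<^sub>p (1 - of_rat q + y) / \<Gamma>\<^sub>p (1 - of_rat q) * floor_factor (1 - q + ?s)"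
    using G_shift_bounds[OF j] q y by (subst G_factor_eq[OF odd]) (auto simp: of_rat_eqs)
  moreover have "(\<Gamma>\<^sub>p (- y))\<^sup>2 = 1 / (\<Gamma>\<^sub>p (1 + y))\<^sup>2"
    using Gamma_p_reflection_square[OF odd, of "- y"] Gamma_p_unit[OF odd, of "1 + y"] y
    by (simp add: power_mult_distrib padic_unitsD(2) eq_divide_eq)
  moreover have "- 1 / (padic_p - 1) = 1 / (1 - padic_p :: 'p padic)"
    by (metis minus_diff_eq minus_divide_divide minus_minus)
  ultimately show ?thesis
    unfolding G_term_def padic_gamma_rat_eq_Gamma_p of_rat_eqs y_def[symmetric]
    by (simp add: gamma_quotient_def ac_simps)
qed

lemma floor_factor_mult_cong_0:
  assumes "t < 0" "u < 0" "of_rat t \<in> (\<int>\<^sub>p :: 'p :: prime_card padic set)"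
    and "of_rat u \<in> (\<int>\<^sub>p :: 'p padic set)"
  shows "[floor_factor t * floor_factor u \<equiv> (0 :: 'p padic)] (mod CARD('p)\<^sup>2)"
proof -
  obtain v w where "floor_factor t = (padic_p * v :: 'p padic)" "v \<in> \<int>\<^sub>p"
    and "floor_factor u = (padic_p * w :: 'p padic)" "w \<in> \<int>\<^sub>p"
    using floor_factor_neg_cong_0[OF assms(1,3)] floor_factor_neg_cong_0[OF assms(2,4)]
    by (metis add_0 padic_congE)
  then show ?thesis
    by (intro padic_congI[of _ _ _ "v * w"]) (auto simp: power2_eq_square)
qed

lemma gamma_quotient_shift_in_Zp:
  assumes "odd CARD('p :: prime_card)" "b \<in> (\<int>\<^sub>p :: 'p padic set)"
  shows "gamma_quotient b (of_rat (G_shift CARD('p) j)) / (1 - padic_p) \<in> (\<int>\<^sub>p :: 'p padic set)"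
  using padic_units_1_plus[of "- 1 :: 'p padic"]
  by (intro Zp_divide padic_unitsD(1)[OF gamma_quotient_unit] assms of_rat_G_shift_in_Zp) simp

lemma Zp_G_term:
  fixes q :: rat
  assumes "odd CARD('p :: prime_card)" "0 < q" "q < 1" "of_rat q \<in> (\<int>\<^sub>p :: 'p padic set)" "j < CARD('p)"
  shows "G_term q j \<in> (\<int>\<^sub>p :: 'p padic set)"
  unfolding G_term_eq[OF assms] using assms(4) of_rat_G_shift_in_Zp[where ?'p = 'p]
  by (intro Zp_mult gamma_quotient_shift_in_Zp assms Zp_floor_factor)
    (simp_all add: of_rat_add of_rat_diff)

lemma G_term_cong_0:
  fixes q :: rat
  assumes odd: "odd CARD('p :: prime_card)" and q: "0 < q" "q < 1" "of_rat q \<in> (\<int>\<^sub>p :: 'p padic set)"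
    and j: "j < CARD('p)" and neg: "q + G_shift CARD('p) j < 0" "1 - q + G_shift CARD('p) j < 0"
  shows "[G_term q j \<equiv> (0 :: 'p padic)] (mod CARD('p)\<^sup>2)"
proof -
  have "[floor_factor (q + G_shift CARD('p) j) * floor_factor (1 - q + G_shift CARD('p) j) \<equiv>
      (0 :: 'p padic)] (mod CARD('p)\<^sup>2)"
    using q of_rat_G_shift_in_Zp[where ?'p = 'p]
    by (intro floor_factor_mult_cong_0 neg) (simp_all add: of_rat_add of_rat_diff)
  with gamma_quotient_shift_in_Zp[OF odd q(3)]
  have "[G_term q j \<equiv>
      gamma_quotient (of_rat q) (of_rat (G_shift CARD('p) j)) / (1 - padic_p) * (0 :: 'p padic)]
      (mod CARD('p)\<^sup>2)"
    unfolding G_term_eq[OF odd q j] by (intro padic_cong_mult padic_cong_refl)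
  then show ?thesis
    by simp
qed

lemma padic_G_cong_sum_G_term:
  fixes q :: rat
  assumes odd: "odd CARD('p :: prime_card)" and q: "0 < q" "q < 1" "of_rat q \<in> (\<int>\<^sub>p :: 'p padic set)"
  shows "[padic_G [q, 1 - q] \<equiv> (\<Sum>j = 0..CARD('p) - 1. G_term q j :: 'p padic)] (mod CARD('p)\<^sup>2)"
proof -
  define m where "m = CARD('p) - 2"
  have m: "CARD('p) - 1 = Suc m" "CARD('p) = Suc (Suc m)"
    using CARD_prime_card_gt_1[where ?'p = 'p] by (auto simp: m_def)
  have "G_shift CARD('p) (Suc m) = - 1"
    unfolding m(2) by (simp add: G_shift_def)
  then have last: "[G_term q (Suc m) \<equiv> (0 :: 'p padic)] (mod CARD('p)\<^sup>2)"
    using q by (intro G_term_cong_0 odd) (simp_all add: m(2))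
  have "(\<Sum>j = 0..m. G_term q j) \<in> (\<int>\<^sub>p :: 'p padic set)"
    by (intro Zp_sum Zp_G_term odd q) (simp add: m(2))
  then have "[(\<Sum>j = 0..m. G_term q j) + 0 \<equiv> (\<Sum>j = 0..m. G_term q j) + (G_term q (Suc m) :: 'p padic)]
      (mod CARD('p)\<^sup>2)"
    by (intro padic_cong_add padic_cong_refl padic_cong_sym[OF last])
  then show ?thesis
    unfolding padic_G_eq_sum_G_term m(1) by (simp add: m_def[symmetric])
qed

lemma padic_cong_0_iff_eq_p:
  assumes "[x \<equiv> (of_nat i :: 'p :: prime_card padic)] (mod CARD('p))" "0 < i" "i \<le> CARD('p)"
  shows "[x \<equiv> 0] (mod CARD('p)) \<longleftrightarrow> i = CARD('p)"
proof -
  have "[x \<equiv> 0] (mod CARD('p)) \<longleftrightarrow> [of_nat i \<equiv> (0 :: 'p padic)] (mod CARD('p))"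
    using assms(1) by (meson padic_cong_sym padic_cong_trans)
  also have "\<dots> \<longleftrightarrow> CARD('p) dvd i"
    by (rule padic_cong_of_nat_0_iff)
  also have "\<dots> \<longleftrightarrow> i = CARD('p)"
    using assms(2,3) nat_dvd_not_less[of i "CARD('p)"] by (auto simp: le_less)
  finally show ?thesis .
qed

section \<open>The congruence for unit fractions\<close>

locale unit_fraction_mod_p =
  fixes d r :: nat and a :: "'p :: prime_card padic"
  assumes odd_p: "odd CARD('p)" and d_ge_2: "d \<ge> 2"
    and p_cases: "CARD('p) = d * r + 1 \<or> CARD('p) + 1 = d * (r + 1)"
    and a_eq: "a = 1 / of_nat d"
begin

abbreviation unit_frac :: rat where
  "unit_frac \<equiv> 1 / of_nat d"

abbreviation padic_shift :: "nat \<Rightarrow> 'p padic" where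
  "padic_shift j \<equiv> of_rat (G_shift CARD('p) j)"

lemma two_r_less: "2 * r < CARD('p)"
  using p_cases
proof
  assume "CARD('p) = d * r + 1"
  then show ?thesis
    using mult_le_mono1[OF d_ge_2, of r] by linarith
next
  assume "CARD('p) + 1 = d * (r + 1)"
  then have "2 * (r + 1) \<le> CARD('p) + 1"
    using d_ge_2 by (simp only: mult_le_mono1)
  then show ?thesis
    by simp
qed

lemma of_nat_d_unit: "of_nat d \<in> (padic_units :: 'p padic set)"
proof (rule padic_units_of_nat, rule notI)
  assume "CARD('p) dvd d"
  then have "CARD('p) dvd d * r" "CARD('p) dvd d * (r + 1)"
    by (auto intro: dvd_mult2)
  then have "CARD('p) dvd 1"
    using p_cases by (metis dvd_add_right_iff dvd_refl)
  then show False
    using CARD_prime_card_gt_1[where ?'p = 'p] by simp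
qed

lemma a_in_Zp: "a \<in> \<int>\<^sub>p"
  using of_nat_d_unit by (simp add: a_eq)

lemma a_expansion:
  "CARD('p) = d * r + 1 \<Longrightarrow> a = - of_nat r + padic_p * a"
  "CARD('p) + 1 = d * (r + 1) \<Longrightarrow> 1 - a = - of_nat r + padic_p * a"
proof -
  have d_nonzero: "of_nat d \<noteq> (0 :: 'p padic)"
    using of_nat_d_unit by (rule padic_unitsD)
  show "a = - of_nat r + padic_p * a" if "CARD('p) = d * r + 1"
    using that d_nonzero by (simp add: a_eq field_simps)
  show "1 - a = - of_nat r + padic_p * a" if "CARD('p) + 1 = d * (r + 1)"
  proof -
    have "padic_p + 1 = (of_nat d * (of_nat r + 1) :: 'p padic)"
      using arg_cong[OF that, of "of_nat :: nat \<Rightarrow> 'p padic"] by (simp add: algebra_simps)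
    then show ?thesis
      using d_nonzero by (simp add: a_eq field_simps)
  qed
qed

lemma shift_nonneg_iff:
  "0 \<le> unit_frac + G_shift CARD('p) j \<longleftrightarrow> j * d \<le> CARD('p) - 1"
  "0 \<le> 1 - unit_frac + G_shift CARD('p) j \<longleftrightarrow> j * d + (CARD('p) - 1) \<le> d * (CARD('p) - 1)"
proof -
  define m where "m = CARD('p) - 1"
  have "m > 0" "of_nat CARD('p) - 1 = (of_nat m :: rat)"
    using CARD_prime_card_gt_1[where ?'p = 'p] by (auto simp: m_def of_nat_diff)
  then show "0 \<le> unit_frac + G_shift CARD('p) j \<longleftrightarrow> j * d \<le> CARD('p) - 1"
    "0 \<le> 1 - unit_frac + G_shift CARD('p) j \<longleftrightarrow> j * d + (CARD('p) - 1) \<le> d * (CARD('p) - 1)"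
    using d_ge_2 unfolding m_def[symmetric] G_shift_def
    by (simp_all add: field_simps flip: of_nat_mult of_nat_add)
qed

lemma unit_frac_bounds: "0 < unit_frac" "unit_frac \<le> 1 - unit_frac" "unit_frac < 1"
  using d_ge_2 by (auto simp: field_simps)

lemma of_rat_unit_frac: "of_rat unit_frac = a"
  by (simp add: a_eq of_rat_divide)

lemma shift_nonneg_head:
  assumes "j \<le> r"
  shows "0 \<le> unit_frac + G_shift CARD('p) j" "0 \<le> 1 - unit_frac + G_shift CARD('p) j"
proof -
  have "j * d \<le> r * d"
    using assms by simp
  also have "\<dots> \<le> CARD('p) - 1"
    using p_cases d_ge_2 by (auto simp: algebra_simps)
  finally show "0 \<le> unit_frac + G_shift CARD('p) j"
    unfolding shift_nonneg_iff .
  then show "0 \<le> 1 - unit_frac + G_shift CARD('p) j"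
    using unit_frac_bounds(2) by linarith
qed

lemma shift_neg_after_head:
  assumes "r < j"
  shows "unit_frac + G_shift CARD('p) j < 0"
proof -
  have "(r + 1) * d \<le> j * d"
    using assms by (intro mult_le_mono1) simp
  then have "\<not> j * d \<le> CARD('p) - 1"
    using p_cases d_ge_2 assms by (auto simp: algebra_simps)
  then show ?thesis
    unfolding not_le[symmetric] shift_nonneg_iff .
qed

lemma shift_neg_tail:
  assumes "CARD('p) - r \<le> j"
  shows "unit_frac + G_shift CARD('p) j < 0" "1 - unit_frac + G_shift CARD('p) j < 0"
proof -
  define m where "m = CARD('p) - 1"
  have m: "m = r * d \<or> m + 2 = r * d + d"
    using p_cases d_ge_2 by (auto simp: m_def algebra_simps)
  have "m + 1 \<le> j + r"
    using assms CARD_prime_card_gt_1[where ?'p = 'p] by (simp add: m_def)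
  then have "(m + 1) * d \<le> (j + r) * d"
    by (rule mult_le_mono1)
  then have "\<not> j * d + m \<le> d * m"
    using m d_ge_2 by (auto simp: algebra_simps)
  then show "1 - unit_frac + G_shift CARD('p) j < 0"
    unfolding m_def not_le[symmetric] shift_nonneg_iff .
  then show "unit_frac + G_shift CARD('p) j < 0"
    using unit_frac_bounds(2) by linarith
qed

lemma padic_shift_cong: "[padic_shift j \<equiv> of_nat j] (mod CARD('p))"
  by (intro padic_congI[OF of_rat_G_shift_eq]) (auto intro: of_rat_G_shift_in_Zp)

lemma shift_nonneg_middle_iff_if_p_eq_1_mod:
  assumes p: "CARD('p) = d * r + 1" and j: "r < j" "j < CARD('p) - r"
  shows "0 \<le> 1 - unit_frac + G_shift CARD('p) j \<longleftrightarrow> \<not> [a + padic_shift j \<equiv> 0] (mod CARD('p))"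
proof -
  have "[a \<equiv> - of_nat r] (mod CARD('p))"
    using a_in_Zp by (intro padic_congI[OF a_expansion(1)[OF p]]) auto
  then have "[a + padic_shift j \<equiv> - of_nat r + of_nat j] (mod CARD('p))"
    by (intro padic_cong_add padic_shift_cong)
  then have "\<not> [a + padic_shift j \<equiv> 0] (mod CARD('p))"
    using j by (subst padic_cong_0_iff_eq_p[of _ "j - r"]) (auto simp: of_nat_diff)
  moreover have "(j + r) * d \<le> d * r * d"
    using p j by (intro mult_le_mono1) simp
  then have "j * d + (CARD('p) - 1) \<le> d * (CARD('p) - 1)"
    using p by (simp add: algebra_simps)
  ultimately show ?thesis
    by (simp only: shift_nonneg_iff not_False_eq_True)
qed

lemma shift_nonneg_middle_iff_if_p_eq_minus_1_mod:
  assumes p: "CARD('p) + 1 = d * (r + 1)" and j: "r < j" "j < CARD('p) - r"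
  shows "0 \<le> 1 - unit_frac + G_shift CARD('p) j \<longleftrightarrow> \<not> [a + padic_shift j \<equiv> 0] (mod CARD('p))"
proof -
  have "a = of_nat (r + 1) + padic_p * (- a)"
    using a_expansion(2)[OF p] by (simp add: algebra_simps)
  then have "[a \<equiv> of_nat (r + 1)] (mod CARD('p))"
    by (rule padic_congI) (use a_in_Zp in auto)
  then have "[a + padic_shift j \<equiv> of_nat (r + 1) + of_nat j] (mod CARD('p))"
    by (intro padic_cong_add padic_shift_cong)
  then have "[a + padic_shift j \<equiv> 0] (mod CARD('p)) \<longleftrightarrow> r + 1 + j = CARD('p)"
    using j by (intro padic_cong_0_iff_eq_p) (auto simp: add.assoc)
  moreover define m where "m = CARD('p) - 1"
  then have m: "CARD('p) = m + 1" "m + 2 = d * r + d"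
    using p by simp_all
  have "j * d + m \<le> d * m \<longleftrightarrow> r + 1 + j \<noteq> CARD('p)"
  proof (cases "r + 1 + j = CARD('p)")
    case True
    then have "m = j + r"
      using m(1) by simp
    moreover have "d \<noteq> 2"
      using m(2) \<open>m = j + r\<close> j(1) by auto
    ultimately have "d * m < j * d + m"
      using d_ge_2 m(2) by (simp add: algebra_simps)
    with True show ?thesis
      by simp
  next
    case False
    then have "(j + r + 1) * d \<le> m * d"
      using j m(1) by (intro mult_le_mono1) simp
    then have "j * d + m \<le> d * m"
      using m(2) by (simp add: algebra_simps)
    with False show ?thesis
      by simp
  qed
  ultimately show ?thesis
    by (simp add: shift_nonneg_iff m_def)
qed

lemma shift_nonneg_middle_iff:
  assumes "r < j" "j < CARD('p) - r"
  shows "0 \<le> 1 - unit_frac + G_shift CARD('p) j \<longleftrightarrow> \<not> [a + padic_shift j \<equiv> 0] (mod CARD('p))"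
  using p_cases shift_nonneg_middle_iff_if_p_eq_1_mod shift_nonneg_middle_iff_if_p_eq_minus_1_mod assms
  by blast

lemma G_term_head:
  assumes "j \<le> r"
  shows "G_term unit_frac j = gamma_quotient a (padic_shift j) / (1 - padic_p)"
proof -
  have "j < CARD('p)"
    using assms two_r_less by simp
  then show ?thesis
    using G_term_eq[OF odd_p, of unit_frac j] unit_frac_bounds a_in_Zp shift_nonneg_head[OF assms]
    by (simp add: of_rat_unit_frac floor_factor_def)
qed

lemma G_term_middle:
  assumes "r < j" "j < CARD('p) - r"
  shows "[G_term unit_frac j \<equiv>
      padic_p * (a + padic_shift j) * (gamma_quotient a (padic_shift j) / (1 - padic_p))]
    (mod CARD('p)\<^sup>2)"
proof -
  let ?X = "gamma_quotient a (padic_shift j) / (1 - padic_p)"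
  have X: "?X \<in> \<int>\<^sub>p"
    using odd_p a_in_Zp by (rule gamma_quotient_shift_in_Zp)
  have sum_in_Zp: "a + padic_shift j \<in> \<int>\<^sub>p"
    using a_in_Zp of_rat_G_shift_in_Zp by (rule Zp_add)
  have j: "j < CARD('p)"
    using assms by simp
  note neg = shift_neg_after_head[OF assms(1)]
  show ?thesis
  proof (cases "0 \<le> 1 - unit_frac + G_shift CARD('p) j")
    case True
    then have "\<not> [a + padic_shift j \<equiv> 0] (mod CARD('p))"
      using shift_nonneg_middle_iff[OF assms] by simp
    then have "G_term unit_frac j = padic_p * (a + padic_shift j) * ?X"
      using True neg G_term_eq[OF odd_p, of unit_frac j] unit_frac_bounds a_in_Zp j
      by (simp add: of_rat_unit_frac of_rat_add floor_factor_def ac_simps)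
    then show ?thesis
      using X sum_in_Zp by (simp only:) (intro padic_cong_refl Zp_mult Zp_of_nat)
  next
    case False
    then have "[a + padic_shift j \<equiv> 0] (mod CARD('p))"
      using shift_nonneg_middle_iff[OF assms] by simp
    then have "[padic_p * ((a + padic_shift j) * ?X) \<equiv> padic_p * (0 * ?X)] (mod CARD('p)\<^sup>2)"
      using X by (intro padic_cong_scale_p padic_cong_mult padic_cong_refl)
    then have "[padic_p * (a + padic_shift j) * ?X \<equiv> 0] (mod CARD('p)\<^sup>2)"
      by (simp only: mult.assoc mult_zero_left mult_zero_right)
    moreover have "[G_term unit_frac j \<equiv> (0 :: 'p padic)] (mod CARD('p)\<^sup>2)"
      using unit_frac_bounds a_in_Zp
      by (intro G_term_cong_0 odd_p neg j False[unfolded not_le]) (auto simp: of_rat_unit_frac)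
    ultimately show ?thesis
      using padic_cong_sym padic_cong_trans by blast
  qed
qed

lemma G_term_tail:
  assumes "CARD('p) - r \<le> j" "j < CARD('p)"
  shows "[G_term unit_frac j \<equiv> (0 :: 'p padic)] (mod CARD('p)\<^sup>2)"
  using assms unit_frac_bounds a_in_Zp shift_neg_tail[OF assms(1)]
  by (intro G_term_cong_0 odd_p) (auto simp: of_rat_unit_frac)

lemma sum_G_term_cong_sum_hyp_term:
  "[(\<Sum>j = 0..CARD('p) - 1. G_term unit_frac j) \<equiv> (\<Sum>j = 0..CARD('p) - 1. hyp_term a j)] (mod CARD('p)\<^sup>2)"
proof -
  obtain b where b: "b = - of_nat r + padic_p * a" "b = a \<or> b = 1 - a"
    using p_cases a_expansion by metis
  interpret padic_near_neg_nat r a b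
    using odd_p two_r_less a_in_Zp b(1) by unfold_locales
  have "gamma_quotient b = gamma_quotient a" "hyp_term b = hyp_term a"
    using b(2) by (auto simp: gamma_quotient_reflect hyp_term_reflect)
  then show ?thesis
    using sum_cong_sum_hyp_term[of padic_shift "G_term unit_frac",
        OF of_rat_G_shift_in_Zp of_rat_G_shift_eq]
      G_term_head G_term_middle G_term_tail by simp
qed

theorem padic_G_cong_truncated_hypergeometric:
  "[padic_G [unit_frac, 1 - unit_frac] \<equiv>
    (of_rat (truncated_hypergeometric [unit_frac, 1 - unit_frac] [1] 1 (CARD('p) - 1)) :: 'p padic)]
    (mod CARD('p)\<^sup>2)"
proof -
  have "[padic_G [unit_frac, 1 - unit_frac] \<equiv> (\<Sum>j = 0..CARD('p) - 1. G_term unit_frac j :: 'p padic)]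
      (mod CARD('p)\<^sup>2)"
    using unit_frac_bounds a_in_Zp by (intro padic_G_cong_sum_G_term odd_p) (auto simp: of_rat_unit_frac)
  also note sum_G_term_cong_sum_hyp_term
  finally show ?thesis
    by (simp only: of_rat_truncated_hypergeometric of_rat_unit_frac)
qed

end

lemma cong_1_or_minus_1_obtain_quotient:
  fixes d p :: nat
  assumes "p > 0" "[int p = 1] (mod int d) \<or> [int p = - 1] (mod int d)"
  obtains r where "p = d * r + 1 \<or> p + 1 = d * (r + 1)"
  using assms(2)
proof
  assume "[int p = 1] (mod int d)"
  then have "[p = 1] (mod d)"
    by (simp flip: cong_int_iff)
  then obtain r where "p = d * r + 1"
    using assms(1) cong_le_nat[of 1 p d] by (metis One_nat_def Suc_leI mult.commute)
  then show ?thesis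
    using that by blast
next
  assume "[int p = - 1] (mod int d)"
  then have "int d dvd int (p + 1)"
    by (simp add: cong_iff_dvd_diff add.commute)
  then obtain s where "p + 1 = d * s"
    by (metis of_nat_dvd_iff dvdE)
  then show ?thesis
    using that by (cases s) auto
qed

theorem theorem2p4:
  fixes d p :: nat
  assumes "d \<ge> 2"
    and "p = CARD('p :: prime_card)" and "prime p" and "odd p"
    and "[int p = 1] (mod int d) \<or> [int p = - 1] (mod int d)"
  shows "padic_cong
    (padic_G [1 / of_nat d, 1 - 1 / of_nat d] :: 'p padic)
    (of_rat (truncated_hypergeometric [1 / of_nat d, 1 - 1 / of_nat d] [1] 1 (p - 1)))
    (p\<^sup>2)"
proof -
  obtain r where "p = d * r + 1 \<or> p + 1 = d * (r + 1)"
    using prime_gt_0_nat[OF assms(3)] assms(5) by (rule cong_1_or_minus_1_obtain_quotient)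
  then interpret unit_fraction_mod_p d r "1 / of_nat d :: 'p padic"
    using assms by unfold_locales auto
  show ?thesis
    using padic_G_cong_truncated_hypergeometric by (simp only: assms(2))
qed

end
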